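(* Let $0<p<1$ and let $1\le k\le n$ be integers. Let $T(n,p)$ be the random threshold graph with parameters $n$ and $p$. Then $$\mathbb{E}\big(\beta_k(\Bbbk[T(n,p)])\big)=\binom{n+1}{k+1}\cdot\frac{p(1-p^k)}{1-p}.$$
   Context: For $n\ge 1$ and $\sigma\subseteq\{1,\dots,n\}$, $T(n,\sigma)$ is the (threshold) graph with vertex set $\{0,1,\dots,n\}$ in which, for $0\le u<v\le n$, the pair $uv$ is an edge if and only if $v\notin\sigma$. The random threshold graph $T(n,p)$, for $p\in[0,1]$, is $T(n,\sigma)$ where $\sigma$ is the random subset of $\{1,\dots,n\}$ containing each $i$ independently with probability $p$. Let $\Bbbk$ be a field and $R=\Bbbk[x_0,\dots,x_n]$. For a threshold graph $T=T(n,\sigma)$, let $I_c(T)=\langle x_ux_v\mid u\neq v,\ uv\notin E(T)\rangle$ and $\Bbbk[T]=R/I_c(T)$. The graded Betti numbers $\beta_{i,j}(\Bbbk[T])$ vanish unless $j=i+1$ or $(i,j)=(0,0)$, and $\beta_k(\Bbbk[T])$ denotes $\beta_{k,k+1}(\Bbbk[T])$. *)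

theory Defs
  imports
    "HOL-Library.Poly_Mapping"
    "HOL-Probability.Product_PMF"
    "HOL-Algebra.Module"
    "HOL-Algebra.QuotRing"
begin

section \<open>Threshold graphs\<close>

text \<open>A simple graph is a vertex set together with a set of two-element edges.\<close>

type_synonym 'v graph = "'v set \<times> 'v set set"

definition threshold_graph :: "nat \<Rightarrow> nat set \<Rightarrow> nat graph" where
  "threshold_graph n \<sigma> = ({0..n}, {{u, v} | u v. u < v \<and> v \<le> n \<and> v \<notin> \<sigma>})"

definition random_threshold_graph :: "nat \<Rightarrow> real \<Rightarrow> nat graph pmf" where
  "random_threshold_graph n p =
     map_pmf (\<lambda>b. threshold_graph n {i \<in> {1..n}. b i})
       (Pi_pmf {1..n} False (\<lambda>_. bernoulli_pmf p))"

section \<open>Polynomial rings\<close>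

text \<open>
  A polynomial is a finitely supported map from monomials (exponent vectors) to coefficients.
  The type admits all variables of type \<open>'v\<close>; the carrier of \<open>poly_ring V\<close> restricts to the
  polynomials in the variables \<open>x_v\<close> with \<open>v \<in> V\<close>.
\<close>

type_synonym ('v, 'k) mpoly = "('v \<Rightarrow>\<^sub>0 nat) \<Rightarrow>\<^sub>0 'k"

definition poly_ring :: "'v set \<Rightarrow> ('v, 'k::field) mpoly ring" where
  "poly_ring V =
     \<lparr>carrier = {f. \<forall>m \<in> Poly_Mapping.keys f. Poly_Mapping.keys m \<subseteq> V},
      mult = (*), one = 1, zero = 0, add = (+)\<rparr>"

definition var :: "'v \<Rightarrow> ('v, 'k::field) mpoly" where
  "var v = Poly_Mapping.single (Poly_Mapping.single v 1) 1"

definition mono_deg :: "('v \<Rightarrow>\<^sub>0 nat) \<Rightarrow> nat" where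
  "mono_deg m = (\<Sum>v \<in> Poly_Mapping.keys m. Poly_Mapping.lookup m v)"

text \<open>The zero polynomial lies in every homogeneous component.\<close>

definition homogeneous_part :: "'v set \<Rightarrow> nat \<Rightarrow> ('v, 'k::field) mpoly set" where
  "homogeneous_part V d =
     {f \<in> carrier (poly_ring V). \<forall>m \<in> Poly_Mapping.keys f. mono_deg m = d}"

definition irrelevant_ideal :: "'v set \<Rightarrow> ('v, 'k::field) mpoly set" where
  "irrelevant_ideal V = Idl\<^bsub>poly_ring V\<^esub> (var ` V)"

section \<open>Graded modules and graded Betti numbers\<close>

text \<open>
  A graded module record adds the homogeneous components to a module record. As the
  graded rings here are \<open>\<nat>\<close>-graded, so are the modules.
\<close>

record ('a, 'm) graded_module = "('a, 'm) module" +
  component :: "nat \<Rightarrow> 'm set"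

text \<open>
  Elements of the free module \<open>R^r\<close> are sequences that vanish from position \<open>r\<close> on.
\<close>

definition free_module :: "'v set \<Rightarrow> nat \<Rightarrow> (nat \<Rightarrow> ('v, 'k::field) mpoly) set" where
  "free_module V r = {w. (\<forall>s < r. w s \<in> carrier (poly_ring V)) \<and> (\<forall>s \<ge> r. w s = 0)}"

text \<open>
  The \<open>R\<close>-linear map \<open>R^r \<rightarrow> R^q\<close> that sends the \<open>s\<close>-th basis vector to
  the vector with entries \<open>A s t\<close>, \<open>t < q\<close>.
\<close>

definition free_map ::
    "nat \<Rightarrow> nat \<Rightarrow> (nat \<Rightarrow> nat \<Rightarrow> ('v, 'k::field) mpoly) \<Rightarrow>
     (nat \<Rightarrow> ('v, 'k) mpoly) \<Rightarrow> nat \<Rightarrow> ('v, 'k) mpoly" where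
  "free_map r q A w = (\<lambda>t. if t < q then \<Sum>s<r. w s * A s t else 0)"

definition augmentation ::
    "(('v, 'k::field) mpoly, 'm, 'z) module_scheme \<Rightarrow> nat \<Rightarrow> (nat \<Rightarrow> 'm) \<Rightarrow>
     (nat \<Rightarrow> ('v, 'k) mpoly) \<Rightarrow> 'm" where
  "augmentation M r g w = (\<Oplus>\<^bsub>M\<^esub>s \<in> {..<r}. w s \<odot>\<^bsub>M\<^esub> g s)"

text \<open>
  The data describe a complex
  \<open>\<dots> \<rightarrow> F_2 \<rightarrow> F_1 \<rightarrow> F_0 \<rightarrow> M \<rightarrow> 0\<close>, where \<open>F_i\<close> is the direct sum of the
  \<open>R(-d i s)\<close> for \<open>s < r i\<close>: the \<open>s\<close>-th basis vector of \<open>F_i\<close> has degree \<open>d i s\<close>.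
  The map \<open>F_(i+1) \<rightarrow> F_i\<close> is given by the matrix \<open>A (i + 1)\<close> (the matrix \<open>A 0\<close> is not used), and
  \<open>F_0 \<rightarrow> M\<close> by the images \<open>g\<close> of the basis vectors. The conditions are, in order: the maps
  are homogeneous of degree 0 (two clauses), the complex is exact at \<open>M\<close>, at \<open>F_0\<close> and at
  \<open>F_i\<close> for \<open>i > 0\<close>, and \<open>F_(i+1)\<close> is mapped into the product of the irrelevant ideal
  with \<open>F_i\<close>.
\<close>

definition minimal_graded_free_resolution ::
    "'v set \<Rightarrow> (('v, 'k::field) mpoly, 'm) graded_module \<Rightarrow>
     (nat \<Rightarrow> nat) \<Rightarrow> (nat \<Rightarrow> nat \<Rightarrow> nat) \<Rightarrow> (nat \<Rightarrow> 'm) \<Rightarrow>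
     (nat \<Rightarrow> nat \<Rightarrow> nat \<Rightarrow> ('v, 'k) mpoly) \<Rightarrow> bool" where
  "minimal_graded_free_resolution V M r d g A \<longleftrightarrow>
     (\<forall>s < r 0. g s \<in> component M (d 0 s)) \<and>
     (\<forall>i. \<forall>s < r (Suc i). \<forall>t < r i.
        A (Suc i) s t \<noteq> 0 \<longrightarrow>
          d i t \<le> d (Suc i) s \<and> A (Suc i) s t \<in> homogeneous_part V (d (Suc i) s - d i t)) \<and>
     augmentation M (r 0) g ` free_module V (r 0) = carrier M \<and>
     {w \<in> free_module V (r 0). augmentation M (r 0) g w = \<zero>\<^bsub>M\<^esub>} =
       free_map (r 1) (r 0) (A 1) ` free_module V (r 1) \<and>
     (\<forall>i. {w \<in> free_module V (r (Suc i)).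
             free_map (r (Suc i)) (r i) (A (Suc i)) w = (\<lambda>_. 0)} =
           free_map (r (Suc (Suc i))) (r (Suc i)) (A (Suc (Suc i)))
             ` free_module V (r (Suc (Suc i)))) \<and>
     (\<forall>i. \<forall>s < r (Suc i). \<forall>t < r i. A (Suc i) s t \<in> irrelevant_ideal V)"

text \<open>
  \<open>graded_betti V M i j\<close> is the number of copies of \<open>R(-j)\<close> in homological degree \<open>i\<close> of a
  minimal graded free resolution of \<open>M\<close> over \<open>R = poly_ring V\<close>; such resolutions exist for
  finite \<open>V\<close> and finitely generated \<open>M\<close>, and the number does not depend on the choice.
\<close>

definition graded_betti ::
    "'v set \<Rightarrow> (('v, 'k::field) mpoly, 'm) graded_module \<Rightarrow> nat \<Rightarrow> nat \<Rightarrow> nat" where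
  "graded_betti V M i j =
     (THE b. \<exists>r d g A. minimal_graded_free_resolution V M r d g A \<and>
                       b = card {s. s < r i \<and> d i s = j})"

section \<open>The quotient ring of a graph\<close>

definition nonedge_ideal :: "'v graph \<Rightarrow> ('v, 'k::field) mpoly set" where
  "nonedge_ideal G =
     Idl\<^bsub>poly_ring (fst G)\<^esub> {var u * var v | u v.
       u \<in> fst G \<and> v \<in> fst G \<and> u \<noteq> v \<and> {u, v} \<notin> snd G}"

text \<open>
  The quotient ring \<open>R/I\<close> by the ideal of non-edges, as a graded \<open>R\<close>-module. The coset
  \<open>I\<close> itself is its zero.
\<close>

definition graph_quotient ::
    "'v graph \<Rightarrow> (('v, 'k::field) mpoly, ('v, 'k) mpoly set) graded_module" where
  "graph_quotient G =
     (let R = poly_ring (fst G); I = nonedge_ideal G; Q = R Quot I in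
      \<lparr>carrier = carrier Q, mult = mult Q, one = one Q, zero = zero Q, add = add Q,
       smult = (\<lambda>a X. (I +>\<^bsub>R\<^esub> a) \<otimes>\<^bsub>Q\<^esub> X),
       component = (\<lambda>d. (\<lambda>f. I +>\<^bsub>R\<^esub> f) ` homogeneous_part (fst G) d)\<rparr>)"

text \<open>The number \<open>\<beta>_k\<close> is the graded Betti number \<open>\<beta>_(k,k+1)\<close> of the quotient ring.\<close>

definition linear_betti :: "'k::field itself \<Rightarrow> 'v graph \<Rightarrow> nat \<Rightarrow> nat" where
  "linear_betti _ G k =
     graded_betti (fst G)
       (graph_quotient G :: (('v, 'k) mpoly, ('v, 'k) mpoly set) graded_module) k (k + 1)"

end

theory Submission
  imports Defs
begin

text \<open>
  Ordering the non-edges \<open>x_u x_v\<close>, \<open>u < v \<in> \<sigma>\<close>, lexicographically by \<open>(v, u)\<close> gives the ideal linear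
  quotients: the colon ideal at \<open>x_u x_v\<close> is generated by the variables \<open>x_y\<close> with \<open>y < u\<close> or
  \<open>u < y < v\<close>, \<open>y \<in> \<sigma>\<close>. Iterated mapping cones with Koszul complexes therefore yield a linear
  minimal resolution, and a chain homotopy argument shows that every minimal graded free resolution
  has the same graded ranks. Expanding the binomial coefficients, \<open>\<beta>_k\<close> counts the pairs of a set
  \<open>W\<close> of \<open>k + 1\<close> vertices and a non-maximal \<open>a \<in> W\<close> such that all elements of \<open>W\<close> above \<open>a\<close> lie in
  \<open>\<sigma>\<close>. Such a pair contributes \<open>p ^ j\<close> to the expectation, where \<open>j\<close> is the number of elements of
  \<open>W\<close> above \<open>a\<close>, so each \<open>W\<close> contributes \<open>p + \<dots> + p ^ k\<close>.
\<close>

section \<open>Polynomials and monomial ideals\<close>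

text \<open>\<open>graded_betti\<close> is a definite description over all minimal graded free
  resolutions, so exhibiting one is not enough: every other one, with its own number of generators
  of \<open>F_0\<close>, must give the same count. The comparison is therefore carried out for
  arbitrary \<open>gres\<close> data, while the construction uses the more rigid
  \<open>pure_res\<close>, where each homological degree has a single internal degree. Once these
  degrees increase strictly, all matrix entries have positive degree, so minimality is read off from
  degrees at the very end. All ideals are monomial and are handled as predicates on exponent
  vectors; sums and colon ideals then become statements about divisibility. The pairs of
  \<open>W\<close> and \<open>a\<close> arise by reading
  \<open>nonedge_rank \<sigma> a b choose (k - 1)\<close> as the choice of a set \<open>X\<close>:
  its elements below \<open>a\<close> are unrestricted, those between \<open>a\<close> and
  \<open>b\<close> lie in \<open>\<sigma>\<close>, and \<open>W\<close> is \<open>X\<close> together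
  with \<open>a\<close> and \<open>b\<close>, so that \<open>b\<close> is its maximum.\<close>

abbreviation pols :: "'v set \<Rightarrow> ('v, 'k::field) mpoly set" where
  "pols V \<equiv> carrier (poly_ring V)"

lemma pols_iff: "f \<in> pols V \<longleftrightarrow> (\<forall>m \<in> Poly_Mapping.keys f. Poly_Mapping.keys m \<subseteq> V)"
  by (simp add: poly_ring_def)

lemma poly_ring_simps [simp]:
  "mult (poly_ring V) = (*)" "one (poly_ring V) = 1"
  "zero (poly_ring V) = 0" "add (poly_ring V) = (+)"
  by (simp_all add: poly_ring_def)

lemma keys_uminus: "Poly_Mapping.keys (- f) = Poly_Mapping.keys (f :: 'a \<Rightarrow>\<^sub>0 'b::ab_group_add)"
  by (auto simp: in_keys_iff)

lemma poly_mapping_expand: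
  "f = (\<Sum>m\<in>Poly_Mapping.keys f. Poly_Mapping.single m (Poly_Mapping.lookup f m))"
  by (rule poly_mapping_eqI) (auto simp: lookup_sum lookup_single when_def in_keys_iff)

lemma lookup_single_mult:
  fixes f :: "('v, 'k::field) mpoly"
  shows "Poly_Mapping.lookup (Poly_Mapping.single a c * f) (a + m) = c * Poly_Mapping.lookup f m"
proof -
  have "Poly_Mapping.single a c * f
      = (\<Sum>m\<in>Poly_Mapping.keys f. Poly_Mapping.single (a + m) (c * Poly_Mapping.lookup f m))"
    by (subst (1) poly_mapping_expand[of f]) (simp add: sum_distrib_left mult_single)
  then show ?thesis
    by (auto simp: lookup_sum lookup_single when_def in_keys_iff)
qed

lemma keys_single_mult:
  fixes f :: "('v, 'k::field) mpoly"
  assumes "c \<noteq> 0"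
  shows "Poly_Mapping.keys (Poly_Mapping.single a c * f) = (\<lambda>m. a + m) ` Poly_Mapping.keys f"
proof (intro equalityI subsetI)
  fix m assume "m \<in> Poly_Mapping.keys (Poly_Mapping.single a c * f)"
  then show "m \<in> (\<lambda>m. a + m) ` Poly_Mapping.keys f"
    using keys_mult[of "Poly_Mapping.single a c" f] assms by auto
next
  fix m assume "m \<in> (\<lambda>m. a + m) ` Poly_Mapping.keys f"
  then show "m \<in> Poly_Mapping.keys (Poly_Mapping.single a c * f)"
    using assms by (auto simp: in_keys_iff lookup_single_mult)
qed

lemma monomial_add_eq_0_iff: "a + b = 0 \<longleftrightarrow> a = 0 \<and> b = (0 :: 'v \<Rightarrow>\<^sub>0 nat)"
  by (auto simp: poly_mapping_eq_iff fun_eq_iff lookup_add)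

lemma keys_add_nat:
  "Poly_Mapping.keys (a + b :: 'v \<Rightarrow>\<^sub>0 nat) = Poly_Mapping.keys a \<union> Poly_Mapping.keys b"
  by (auto simp: in_keys_iff lookup_add)

lemma mono_deg_superset:
  assumes "finite S" "Poly_Mapping.keys m \<subseteq> S"
  shows "mono_deg m = (\<Sum>v\<in>S. Poly_Mapping.lookup m v)"
  unfolding mono_deg_def
  by (rule sum.mono_neutral_left) (use assms in \<open>auto simp: in_keys_iff\<close>)

lemma mono_deg_add: "mono_deg (a + b) = mono_deg a + mono_deg b"
proof -
  let ?S = "Poly_Mapping.keys a \<union> Poly_Mapping.keys b"
  have "mono_deg (a + b) = (\<Sum>v\<in>?S. Poly_Mapping.lookup (a + b) v)"
    by (rule mono_deg_superset) (simp_all add: keys_add_nat)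
  moreover have "mono_deg a = (\<Sum>v\<in>?S. Poly_Mapping.lookup a v)"
    by (rule mono_deg_superset) simp_all
  moreover have "mono_deg b = (\<Sum>v\<in>?S. Poly_Mapping.lookup b v)"
    by (rule mono_deg_superset) simp_all
  ultimately show ?thesis by (simp add: lookup_add sum.distrib)
qed

lemma mono_deg_0 [simp]: "mono_deg 0 = 0"
  by (simp add: mono_deg_def)

lemma mono_deg_single [simp]: "mono_deg (Poly_Mapping.single v k) = k"
  by (simp add: mono_deg_def)

lemma mono_deg_eq_0_iff: "mono_deg m = 0 \<longleftrightarrow> m = 0"
  by (auto simp: mono_deg_def in_keys_iff poly_mapping_eq_iff fun_eq_iff)

lemma pols_0 [simp]: "0 \<in> pols V" and pols_1 [simp]: "1 \<in> pols V"
  by (simp_all add: pols_iff)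

lemma pols_add: "f \<in> pols V \<Longrightarrow> g \<in> pols V \<Longrightarrow> f + g \<in> pols V"
  using keys_add[of f g] by (auto simp: pols_iff)

lemma pols_uminus: "f \<in> pols V \<Longrightarrow> - f \<in> pols V"
  by (simp add: pols_iff keys_uminus)

lemma pols_diff: "f \<in> pols V \<Longrightarrow> g \<in> pols V \<Longrightarrow> f - g \<in> pols V"
  using pols_add[OF _ pols_uminus] by (metis diff_conv_add_uminus)

lemma pols_mult: "f \<in> pols V \<Longrightarrow> g \<in> pols V \<Longrightarrow> f * g \<in> pols V"
  using keys_mult[of f g] by (fastforce simp: pols_iff keys_add_nat)

lemma pols_sum: "(\<And>i. i \<in> I \<Longrightarrow> f i \<in> pols V) \<Longrightarrow> (\<Sum>i\<in>I. f i) \<in> pols V"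
  by (induction I rule: infinite_finite_induct) (auto intro: pols_add)

lemma pols_single: "Poly_Mapping.keys m \<subseteq> V \<Longrightarrow> Poly_Mapping.single m c \<in> pols V"
  by (auto simp: pols_iff)

lemma poly_ring_cring: "cring (poly_ring V)"
proof (intro cringI abelian_groupI comm_monoidI)
  fix x :: "('a, 'b) mpoly" assume "x \<in> pols V"
  then have "- x \<in> pols V \<and> - x \<oplus>\<^bsub>poly_ring V\<^esub> x = \<zero>\<^bsub>poly_ring V\<^esub>"
    by (simp add: pols_uminus)
  then show "\<exists>y\<in>pols V. y \<oplus>\<^bsub>poly_ring V\<^esub> x = \<zero>\<^bsub>poly_ring V\<^esub>" by blast
qed (simp_all add: pols_add pols_mult algebra_simps)

lemma homogeneous_part_iff:
  "f \<in> homogeneous_part V d \<longleftrightarrow>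
     (\<forall>m\<in>Poly_Mapping.keys f. Poly_Mapping.keys m \<subseteq> V \<and> mono_deg m = d)"
  by (auto simp: homogeneous_part_def pols_iff)

lemma homogeneous_pols: "f \<in> homogeneous_part V d \<Longrightarrow> f \<in> pols V"
  by (simp add: homogeneous_part_def)

lemma homogeneous_0 [simp]: "0 \<in> homogeneous_part V d"
  by (simp add: homogeneous_part_iff)

lemma homogeneous_add:
  "f \<in> homogeneous_part V d \<Longrightarrow> g \<in> homogeneous_part V d \<Longrightarrow> f + g \<in> homogeneous_part V d"
  using keys_add[of f g] by (auto simp: homogeneous_part_iff)

lemma homogeneous_sum:
  "(\<And>i. i \<in> I \<Longrightarrow> f i \<in> homogeneous_part V d) \<Longrightarrow> (\<Sum>i\<in>I. f i) \<in> homogeneous_part V d"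
  by (induction I rule: infinite_finite_induct) (auto intro: homogeneous_add)

lemma homogeneous_uminus: "f \<in> homogeneous_part V d \<Longrightarrow> - f \<in> homogeneous_part V d"
  by (simp add: homogeneous_part_iff keys_uminus)

lemma homogeneous_mult:
  "f \<in> homogeneous_part V d \<Longrightarrow> g \<in> homogeneous_part V e \<Longrightarrow> f * g \<in> homogeneous_part V (d + e)"
  using keys_mult[of f g] by (fastforce simp: homogeneous_part_iff keys_add_nat mono_deg_add)

lemma homogeneous_single:
  "Poly_Mapping.keys m \<subseteq> V \<Longrightarrow> Poly_Mapping.single m c \<in> homogeneous_part V (mono_deg m)"
  by (auto simp: homogeneous_part_iff)

text \<open>One truncation operator for two purposes: homogeneous components, and splitting a
  polynomial into a part inside a monomial ideal and a part whose terms all lie outside it.\<close>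

definition restrict_keys :: "('a \<Rightarrow> bool) \<Rightarrow> ('a \<Rightarrow>\<^sub>0 'b::comm_monoid_add) \<Rightarrow> ('a \<Rightarrow>\<^sub>0 'b)" where
  "restrict_keys Q f =
     (\<Sum>m\<in>{m\<in>Poly_Mapping.keys f. Q m}. Poly_Mapping.single m (Poly_Mapping.lookup f m))"

lemma lookup_restrict_keys:
  "Poly_Mapping.lookup (restrict_keys Q f) m = (if Q m then Poly_Mapping.lookup f m else 0)"
  by (auto simp: restrict_keys_def lookup_sum lookup_single when_def in_keys_iff)

lemma keys_restrict_keys: "Poly_Mapping.keys (restrict_keys Q f) = {m\<in>Poly_Mapping.keys f. Q m}"
  by (auto simp: in_keys_iff lookup_restrict_keys split: if_splits)

lemma restrict_keys_add: "restrict_keys Q (f + g) = restrict_keys Q f + restrict_keys Q g"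
  by (rule poly_mapping_eqI) (simp add: lookup_restrict_keys lookup_add)

lemma restrict_keys_0 [simp]: "restrict_keys Q 0 = 0"
  by (rule poly_mapping_eqI) (simp add: lookup_restrict_keys)

lemma restrict_keys_sum: "restrict_keys Q (\<Sum>i\<in>I. f i) = (\<Sum>i\<in>I. restrict_keys Q (f i))"
  by (induction I rule: infinite_finite_induct) (simp_all add: restrict_keys_add)

lemma restrict_keys_id: "\<forall>m\<in>Poly_Mapping.keys f. Q m \<Longrightarrow> restrict_keys Q f = f"
  by (rule poly_mapping_eqI) (auto simp: lookup_restrict_keys in_keys_iff)

lemma restrict_keys_eq_0: "\<forall>m\<in>Poly_Mapping.keys f. \<not> Q m \<Longrightarrow> restrict_keys Q f = 0"
  by (rule poly_mapping_eqI) (auto simp: lookup_restrict_keys in_keys_iff)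

definition hom_component :: "nat \<Rightarrow> ('v, 'k::field) mpoly \<Rightarrow> ('v, 'k) mpoly" where
  "hom_component e = restrict_keys (\<lambda>m. mono_deg m = e)"

lemma hom_component_add: "hom_component e (f + g) = hom_component e f + hom_component e g"
  by (simp add: hom_component_def restrict_keys_add)

lemma hom_component_diff: "hom_component e (f - g) = hom_component e f - hom_component e g"
  using hom_component_add[of e "f - g" g] by (simp add: eq_diff_eq)

lemma hom_component_sum: "hom_component e (\<Sum>i\<in>I. f i) = (\<Sum>i\<in>I. hom_component e (f i))"
  by (simp add: hom_component_def restrict_keys_sum)

lemma hom_component_0 [simp]: "hom_component e 0 = 0"
  by (simp add: hom_component_def)

lemma hom_component_homogeneous: "f \<in> pols V \<Longrightarrow> hom_component e f \<in> homogeneous_part V e"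
  by (auto simp: hom_component_def homogeneous_part_iff keys_restrict_keys pols_iff)

lemma hom_component_pols: "f \<in> pols V \<Longrightarrow> hom_component e f \<in> pols V"
  by (rule homogeneous_pols[OF hom_component_homogeneous])

lemma hom_component_id: "f \<in> homogeneous_part V e \<Longrightarrow> hom_component e f = f"
  unfolding hom_component_def by (rule restrict_keys_id) (simp add: homogeneous_part_iff)

text \<open>Both sides are additive in \<open>a\<close>, and for a monomial \<open>a\<close> the
  product is homogeneous. The case distinction guards against truncated subtraction.\<close>

lemma hom_component_mult:
  fixes a b :: "('v, 'k::field) mpoly"
  assumes b: "b \<in> homogeneous_part V d"
  shows "hom_component e (a * b) = (if d \<le> e then hom_component (e - d) a * b else 0)"
proof -
  have one: "hom_component e (Poly_Mapping.single m c * b)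
      = (if d \<le> e then hom_component (e - d) (Poly_Mapping.single m c) * b else 0)" for m and c :: 'k
  proof (cases "mono_deg m + d = e")
    case True
    have "hom_component e (Poly_Mapping.single m c * b) = Poly_Mapping.single m c * b"
      unfolding hom_component_def
      by (rule restrict_keys_id) (use True b keys_mult[of "Poly_Mapping.single m c" b] in
          \<open>auto simp: homogeneous_part_iff mono_deg_add split: if_splits\<close>)
    moreover have "hom_component (e - d) (Poly_Mapping.single m c) = Poly_Mapping.single m c"
      unfolding hom_component_def by (rule restrict_keys_id) (use True in auto)
    ultimately show ?thesis using True by auto
  next
    case False
    have "hom_component e (Poly_Mapping.single m c * b) = 0"
      unfolding hom_component_def
      by (rule restrict_keys_eq_0) (use False b keys_mult[of "Poly_Mapping.single m c" b] in
          \<open>auto simp: homogeneous_part_iff mono_deg_add split: if_splits\<close>)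
    moreover have "d \<le> e \<Longrightarrow> hom_component (e - d) (Poly_Mapping.single m c) = 0"
      unfolding hom_component_def by (rule restrict_keys_eq_0) (use False in auto)
    ultimately show ?thesis by auto
  qed
  show ?thesis
    by (subst (1 2) poly_mapping_expand[of a])
      (simp add: sum_distrib_right hom_component_sum one)
qed

text \<open>Evaluation at the origin, that is, reduction modulo the irrelevant ideal. Minimality
  enters the comparison of resolutions only through this ring homomorphism.\<close>

definition const_term :: "('v, 'k::field) mpoly \<Rightarrow> 'k" where
  "const_term f = Poly_Mapping.lookup f 0"

lemma const_term_simps [simp]:
  "const_term 0 = 0" "const_term 1 = 1"
  "const_term (f + g) = const_term f + const_term g"
  "const_term (f - g) = const_term f - const_term g"
  "const_term (- f) = - const_term f"
  by (simp_all add: const_term_def lookup_add lookup_minus)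

lemma const_term_sum: "const_term (\<Sum>i\<in>I. f i) = (\<Sum>i\<in>I. const_term (f i))"
  by (simp add: const_term_def lookup_sum)

lemma const_term_mult [simp]: "const_term (f * g) = const_term f * const_term g"
proof -
  have one: "const_term (Poly_Mapping.single m c * g) = const_term (Poly_Mapping.single m c) * const_term g"
    for m c
  proof (cases "m = 0")
    case True
    then show ?thesis using lookup_single_mult[of 0 c g 0] by (simp add: const_term_def)
  next
    case False
    then have "0 \<notin> Poly_Mapping.keys (Poly_Mapping.single m c * g)"
      using keys_mult[of "Poly_Mapping.single m c" g] by (auto simp: monomial_add_eq_0_iff split: if_splits)
    then show ?thesis
      using False by (simp add: const_term_def in_keys_iff lookup_single)
  qed
  show ?thesis
    by (subst (1 2) poly_mapping_expand[of f]) (simp add: sum_distrib_right const_term_sum one)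
qed

lemma const_term_homogeneous: "f \<in> homogeneous_part V d \<Longrightarrow> d > 0 \<Longrightarrow> const_term f = 0"
  by (metis const_term_def homogeneous_part_iff in_keys_iff mono_deg_0 less_irrefl)

section \<open>Monomial ideals as predicates on exponent vectors\<close>

definition mon_ideal :: "'v set \<Rightarrow> (('v \<Rightarrow>\<^sub>0 nat) \<Rightarrow> bool) \<Rightarrow> ('v, 'k::field) mpoly set" where
  "mon_ideal V U = {f \<in> pols V. \<forall>m\<in>Poly_Mapping.keys f. U m}"

text \<open>Closure under multiplication by monomials, which turns \<open>mon_ideal\<close> into an
  ideal.\<close>

definition upset :: "(('v \<Rightarrow>\<^sub>0 nat) \<Rightarrow> bool) \<Rightarrow> bool" where
  "upset U \<longleftrightarrow> (\<forall>a b. U b \<longrightarrow> U (a + b))"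

lemma mon_ideal_pols: "f \<in> mon_ideal V U \<Longrightarrow> f \<in> pols V"
  by (simp add: mon_ideal_def)

lemma mon_ideal_0 [simp]: "0 \<in> mon_ideal V U"
  by (simp add: mon_ideal_def)

lemma mon_ideal_add: "f \<in> mon_ideal V U \<Longrightarrow> g \<in> mon_ideal V U \<Longrightarrow> f + g \<in> mon_ideal V U"
  using keys_add[of f g] by (auto simp: mon_ideal_def pols_add)

lemma mon_ideal_uminus: "f \<in> mon_ideal V U \<Longrightarrow> - f \<in> mon_ideal V U"
  by (simp add: mon_ideal_def pols_uminus keys_uminus)

lemma mon_ideal_diff: "f \<in> mon_ideal V U \<Longrightarrow> g \<in> mon_ideal V U \<Longrightarrow> f - g \<in> mon_ideal V U"
  using mon_ideal_add[OF _ mon_ideal_uminus] by (metis diff_conv_add_uminus)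

lemma mon_ideal_mult:
  "upset U \<Longrightarrow> f \<in> pols V \<Longrightarrow> g \<in> mon_ideal V U \<Longrightarrow> f * g \<in> mon_ideal V U"
  using keys_mult[of f g] by (force simp: mon_ideal_def pols_mult upset_def)

lemma mon_ideal_mult_right:
  "upset U \<Longrightarrow> g \<in> mon_ideal V U \<Longrightarrow> f \<in> pols V \<Longrightarrow> g * f \<in> mon_ideal V U"
  using mon_ideal_mult[of U f V g] by (simp add: mult.commute)

lemma mon_ideal_sum: "(\<And>i. i \<in> I \<Longrightarrow> f i \<in> mon_ideal V U) \<Longrightarrow> (\<Sum>i\<in>I. f i) \<in> mon_ideal V U"
  by (induction I rule: infinite_finite_induct) (auto intro: mon_ideal_add)

lemma mon_ideal_hom_component: "f \<in> mon_ideal V U \<Longrightarrow> hom_component e f \<in> mon_ideal V U"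
  by (auto simp: mon_ideal_def hom_component_pols) (auto simp: hom_component_def keys_restrict_keys)

lemma mon_ideal_ideal: "upset U \<Longrightarrow> ideal (mon_ideal V U) (poly_ring V)"
proof -
  assume U: "upset U"
  interpret R: cring "poly_ring V" by (rule poly_ring_cring)
  show ?thesis
  proof (rule idealI[OF R.ring_axioms])
    show "subgroup (mon_ideal V U) (add_monoid (poly_ring V))"
    proof (rule R.add.subgroupI)
      show "mon_ideal V U \<noteq> {}" using mon_ideal_0 by blast
      fix f assume f: "f \<in> mon_ideal V U"
      then have "\<ominus>\<^bsub>poly_ring V\<^esub> f = - f"
        by (metis R.minus_equality mon_ideal_pols mon_ideal_uminus add.left_inverse poly_ring_simps(3,4))
      then show "\<ominus>\<^bsub>poly_ring V\<^esub> f \<in> mon_ideal V U"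
        using f by (simp add: mon_ideal_uminus)
    qed (auto simp: mon_ideal_add mon_ideal_pols)
  qed (simp_all add: mon_ideal_mult[OF U] mon_ideal_mult_right[OF U])
qed

lemma genideal_monomials:
  fixes V :: "'v set"
  assumes S: "\<And>a. a \<in> S \<Longrightarrow> Poly_Mapping.keys a \<subseteq> V"
    and U: "\<And>m. U m \<longleftrightarrow> (\<exists>a\<in>S. \<exists>b. m = a + b)"
  shows "Idl\<^bsub>poly_ring V\<^esub> ((\<lambda>a. Poly_Mapping.single a (1::'k::field)) ` S) = mon_ideal V U"
proof
  interpret R: cring "poly_ring V" by (rule poly_ring_cring)
  let ?G = "(\<lambda>a. Poly_Mapping.single a (1::'k)) ` S"
  have up: "upset U"
    unfolding upset_def U by (metis add.left_commute)
  have G: "?G \<subseteq> pols V" using S by (auto intro: pols_single)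
  have "?G \<subseteq> mon_ideal V U"
    using S U by (auto simp: mon_ideal_def intro!: pols_single exI[of _ 0])
  then show "Idl\<^bsub>poly_ring V\<^esub> ?G \<subseteq> mon_ideal V U"
    by (rule R.genideal_minimal[OF mon_ideal_ideal[OF up]])
  interpret I: ideal "Idl\<^bsub>poly_ring V\<^esub> ?G" "poly_ring V" by (rule R.genideal_ideal[OF G])
  have monomial: "Poly_Mapping.single m c \<in> Idl\<^bsub>poly_ring V\<^esub> ?G"
    if m: "Poly_Mapping.keys m \<subseteq> V" "U m" for m c
  proof -
    obtain a b where ab: "a \<in> S" "m = a + b" using m U by blast
    \<comment> \<open>Natural exponents cannot cancel, so the cofactor \<open>b\<close> involves
      only variables that occur in \<open>m\<close>.\<close>
    have "Poly_Mapping.single b c \<in> pols V" using m ab by (auto simp: keys_add_nat intro!: pols_single)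
    moreover have "Poly_Mapping.single a 1 \<in> Idl\<^bsub>poly_ring V\<^esub> ?G"
      using R.genideal_self[OF G] ab by blast
    ultimately have "Poly_Mapping.single b c \<otimes>\<^bsub>poly_ring V\<^esub> Poly_Mapping.single a 1 \<in> Idl\<^bsub>poly_ring V\<^esub> ?G"
      by (rule I.I_l_closed[rotated])
    then show ?thesis by (simp add: mult_single ab add.commute)
  qed
  have sums: "(\<Sum>m\<in>K. f m) \<in> Idl\<^bsub>poly_ring V\<^esub> ?G"
    if "finite K" "\<And>m. m \<in> K \<Longrightarrow> f m \<in> Idl\<^bsub>poly_ring V\<^esub> ?G" for K :: "('v \<Rightarrow>\<^sub>0 nat) set" and f
    using that
  proof (induction K rule: finite_induct)
    case empty
    then show ?case using I.zero_closed by simp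
  next
    case (insert x F)
    then show ?case using I.a_closed[of "f x" "sum f F"] by simp
  qed
  show "mon_ideal V U \<subseteq> Idl\<^bsub>poly_ring V\<^esub> ?G"
  proof
    fix f :: "('v, 'k) mpoly" assume f: "f \<in> mon_ideal V U"
    show "f \<in> Idl\<^bsub>poly_ring V\<^esub> ?G"
      by (subst poly_mapping_expand)
        (rule sums, use f in \<open>auto simp: mon_ideal_def pols_iff intro!: monomial\<close>)
  qed
qed

lemma single_le_iff:
  "(\<exists>b. m = Poly_Mapping.single v 1 + b) \<longleftrightarrow> Poly_Mapping.lookup m v > (0::nat)"
proof
  assume v: "Poly_Mapping.lookup m v > 0"
  have "m = Poly_Mapping.single v 1 + (m - Poly_Mapping.single v 1)"
    by (rule poly_mapping_eqI) (use v in \<open>auto simp: lookup_add lookup_minus lookup_single when_def\<close>)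
  then show "\<exists>b. m = Poly_Mapping.single v 1 + b" ..
qed (auto simp: lookup_add)

lemma irrelevant_ideal_eq:
  "irrelevant_ideal V = mon_ideal V (\<lambda>m. \<exists>v\<in>V. Poly_Mapping.lookup m v > 0)"
proof -
  have "Idl\<^bsub>poly_ring V\<^esub> ((\<lambda>a. Poly_Mapping.single a (1::'b)) ` (\<lambda>v. Poly_Mapping.single v 1) ` V)
     = mon_ideal V (\<lambda>m. \<exists>v\<in>V. Poly_Mapping.lookup m v > 0)"
    by (rule genideal_monomials) (auto simp: single_le_iff[symmetric])
  then show ?thesis
    by (simp add: irrelevant_ideal_def var_def image_image cong: image_cong)
qed

lemma irrelevant_ideal_const_term:
  assumes "f \<in> irrelevant_ideal V"
  shows "const_term f = 0"
proof -
  have "0 \<notin> Poly_Mapping.keys f"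
    using assms by (auto simp: irrelevant_ideal_eq mon_ideal_def)
  then show ?thesis by (simp add: const_term_def in_keys_iff)
qed

text \<open>Turns a positive degree into the membership that the definition of a minimal resolution
  asks for.\<close>

lemma homogeneous_irrelevant_ideal:
  assumes "f \<in> homogeneous_part V d" "d > 0"
  shows "f \<in> irrelevant_ideal V"
proof -
  have "\<exists>v\<in>V. Poly_Mapping.lookup m v > 0" if m: "m \<in> Poly_Mapping.keys f" for m
  proof -
    have "mono_deg m \<noteq> 0" and sub: "Poly_Mapping.keys m \<subseteq> V"
      using assms m by (auto simp: homogeneous_part_iff)
    then obtain v where "Poly_Mapping.lookup m v \<noteq> 0"
      by (metis (full_types) mono_deg_eq_0_iff poly_mapping_eqI lookup_zero)
    then show ?thesis using sub by (metis gr0I in_keys_iff subsetD)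
  qed
  then show ?thesis using assms by (auto simp: irrelevant_ideal_eq mon_ideal_def homogeneous_pols)
qed

section \<open>Homogeneous matrices and lifting\<close>

text \<open>Unlike \<open>free_map\<close>, there is no cut-off in the target index, so the
  composition law \<open>lc_lc\<close> holds without side conditions; here the \<open>s\<close>-th
  row \<open>A s\<close> is the image of the \<open>s\<close>-th basis vector.\<close>

definition lc :: "nat \<Rightarrow> (nat \<Rightarrow> nat \<Rightarrow> ('v, 'k::field) mpoly) \<Rightarrow> (nat \<Rightarrow> ('v, 'k) mpoly) \<Rightarrow> nat \<Rightarrow> ('v, 'k) mpoly" where
  "lc r A w = (\<lambda>t. \<Sum>s<r. w s * A s t)"

definition unit_vec :: "nat \<Rightarrow> nat \<Rightarrow> ('v, 'k::field) mpoly" where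
  "unit_vec s = (\<lambda>t. if t = s then 1 else 0)"

text \<open>The component of degree \<open>e\<close> of the direct sum of the
  \<open>R(-d t)\<close>. The guard on nonzero entries keeps truncated subtraction from admitting
  constants at positions with \<open>d t > e\<close>.\<close>

definition hvec :: "'v set \<Rightarrow> nat \<Rightarrow> (nat \<Rightarrow> nat) \<Rightarrow> nat \<Rightarrow> (nat \<Rightarrow> ('v, 'k::field) mpoly) set" where
  "hvec V q d e = {w \<in> free_module V q. \<forall>t. w t \<noteq> 0 \<longrightarrow> d t \<le> e \<and> w t \<in> homogeneous_part V (e - d t)}"

definition hproj :: "(nat \<Rightarrow> nat) \<Rightarrow> nat \<Rightarrow> (nat \<Rightarrow> ('v, 'k::field) mpoly) \<Rightarrow> nat \<Rightarrow> ('v, 'k) mpoly" where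
  "hproj d e w = (\<lambda>t. if d t \<le> e then hom_component (e - d t) (w t) else 0)"

lemma hvec_free: "w \<in> hvec V q d e \<Longrightarrow> w \<in> free_module V q"
  by (simp add: hvec_def)

lemma free_pols: "w \<in> free_module V q \<Longrightarrow> w t \<in> pols V"
  by (cases "t < q") (auto simp: free_module_def)

lemma free_0 [simp]: "(\<lambda>_. 0) \<in> free_module V q"
  by (simp add: free_module_def)

lemma free_add: "v \<in> free_module V q \<Longrightarrow> w \<in> free_module V q \<Longrightarrow> (\<lambda>t. v t + w t) \<in> free_module V q"
  by (simp add: free_module_def pols_add)

lemma free_diff: "v \<in> free_module V q \<Longrightarrow> w \<in> free_module V q \<Longrightarrow> (\<lambda>t. v t - w t) \<in> free_module V q"
  by (simp add: free_module_def pols_diff)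

lemma free_uminus: "v \<in> free_module V q \<Longrightarrow> (\<lambda>t. - v t) \<in> free_module V q"
  by (simp add: free_module_def pols_uminus)

lemma free_unit_vec: "s < q \<Longrightarrow> unit_vec s \<in> free_module V q"
  by (simp add: free_module_def unit_vec_def)

lemma lc_add: "lc r A (\<lambda>t. v t + w t) = (\<lambda>t. lc r A v t + lc r A w t)"
  by (simp add: lc_def algebra_simps sum.distrib)

lemma lc_diff: "lc r A (\<lambda>t. v t - w t) = (\<lambda>t. lc r A v t - lc r A w t)"
  by (simp add: lc_def algebra_simps sum_subtractf)

lemma lc_uminus: "lc r A (\<lambda>t. - v t) = (\<lambda>t. - lc r A v t)"
  by (simp add: lc_def sum_negf)

lemma lc_0 [simp]: "lc r A (\<lambda>_. 0) = (\<lambda>_. 0)"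
  by (simp add: lc_def)

lemma lc_rows_add: "lc r (\<lambda>s t. A s t + B s t) w = (\<lambda>t. lc r A w t + lc r B w t)"
  by (simp add: lc_def algebra_simps sum.distrib)

lemma lc_cong: "(\<And>s. s < r \<Longrightarrow> A s = B s) \<Longrightarrow> lc r A w = lc r B w"
  by (auto simp: lc_def intro!: sum.cong ext)

lemma lc_lc: "lc q A (lc r B w) = lc r (\<lambda>s. lc q A (B s)) w"
proof
  fix t
  have "lc q A (lc r B w) t = (\<Sum>u<q. \<Sum>s<r. w s * B s u * A u t)"
    by (simp add: lc_def sum_distrib_right)
  also have "\<dots> = (\<Sum>s<r. \<Sum>u<q. w s * B s u * A u t)" by (rule sum.swap)
  finally show "lc q A (lc r B w) t = lc r (\<lambda>s. lc q A (B s)) w t"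
    by (simp add: lc_def sum_distrib_left mult.assoc)
qed

lemma lc_unit_vec: "s < r \<Longrightarrow> lc r A (unit_vec s) = A s"
  by (auto simp: lc_def unit_vec_def if_distrib[of "\<lambda>x. x * _"] cong: if_cong)

lemma lc_unit_rows: "w \<in> free_module V r \<Longrightarrow> lc r unit_vec w = w"
proof
  fix t assume w: "w \<in> free_module V r"
  have "lc r unit_vec w t = (\<Sum>s<r. if s = t then w s else 0)"
    unfolding lc_def unit_vec_def by (rule sum.cong) auto
  then show "lc r unit_vec w t = w t" using w by (auto simp: free_module_def)
qed

lemma lc_free:
  assumes "\<And>s. s < r \<Longrightarrow> A s \<in> free_module V q" "w \<in> free_module V r"
  shows "lc r A w \<in> free_module V q"
  using assms by (auto simp: free_module_def lc_def intro!: pols_sum pols_mult sum.neutral)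

lemma free_map_lc: "free_map r q A = lc r (\<lambda>s t. if t < q then A s t else 0)"
  by (auto simp: free_map_def lc_def intro!: ext)

lemma lc_hvec:
  assumes A: "\<And>s. s < r \<Longrightarrow> A s \<in> hvec V q dq (dr s)" and w: "w \<in> hvec V r dr e"
  shows "lc r A w \<in> hvec V q dq e"
proof -
  have entry: "w s * A s t \<noteq> 0 \<Longrightarrow> dq t \<le> e \<and> w s * A s t \<in> homogeneous_part V (e - dq t)"
    if "s < r" for s t
  proof -
    assume nz: "w s * A s t \<noteq> 0"
    then have "w s \<noteq> 0" "A s t \<noteq> 0" by auto
    then have *: "dr s \<le> e" "w s \<in> homogeneous_part V (e - dr s)"
        "dq t \<le> dr s" "A s t \<in> homogeneous_part V (dr s - dq t)"
      using A[OF that] w by (auto simp: hvec_def)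
    then show ?thesis using homogeneous_mult[OF *(2,4)] by simp
  qed
  have "dq t \<le> e \<and> lc r A w t \<in> homogeneous_part V (e - dq t)" if "lc r A w t \<noteq> 0" for t
  proof
    from that obtain s where "s < r" "w s * A s t \<noteq> 0"
      unfolding lc_def by (meson lessThan_iff sum.not_neutral_contains_not_neutral)
    then show "dq t \<le> e" using entry by blast
    show "lc r A w t \<in> homogeneous_part V (e - dq t)"
      unfolding lc_def by (rule homogeneous_sum) (metis entry lessThan_iff homogeneous_0)
  qed
  moreover have "lc r A w \<in> free_module V q"
    by (rule lc_free) (use A w hvec_free in blast)+
  ultimately show ?thesis by (simp add: hvec_def)
qed

lemma hproj_hvec: "w \<in> free_module V q \<Longrightarrow> hproj d e w \<in> hvec V q d e"
  by (auto simp: hvec_def hproj_def free_module_def hom_component_pols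
      intro: hom_component_homogeneous split: if_splits)
    (metis hom_component_0 hom_component_homogeneous not_le)

lemma hproj_id: "w \<in> hvec V q d e \<Longrightarrow> hproj d e w = w"
proof
  fix t assume "w \<in> hvec V q d e"
  then have "w t \<noteq> 0 \<Longrightarrow> d t \<le> e \<and> w t \<in> homogeneous_part V (e - d t)" by (simp add: hvec_def)
  then show "hproj d e w t = w t"
    by (cases "w t = 0") (auto simp: hproj_def hom_component_id)
qed

text \<open>A matrix with homogeneous rows is a map of degree 0, so it commutes with the projection
  to a degree. This allows an arbitrary preimage of a homogeneous vector to be replaced by a
  homogeneous one.\<close>

lemma hproj_lc:
  assumes A: "\<And>s. s < r \<Longrightarrow> A s \<in> hvec V q dq (dr s)"
  shows "hproj dq e (lc r A w) = lc r A (hproj dr e w)"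
proof
  fix t
  have "(if dq t \<le> e then hom_component (e - dq t) (w s * A s t) else 0) = hproj dr e w s * A s t"
    if "s < r" for s
  proof (cases "A s t = 0")
    case False
    then have *: "dq t \<le> dr s" "A s t \<in> homogeneous_part V (dr s - dq t)"
      using A[OF that] by (auto simp: hvec_def)
    have "hom_component (e - dq t) (w s * A s t)
        = (if dr s \<le> e then hom_component (e - dr s) (w s) * A s t else 0)" if "dq t \<le> e"
      using hom_component_mult[OF *(2), of "e - dq t" "w s"] *(1) that by auto
    then show ?thesis using *(1) by (auto simp: hproj_def)
  qed simp
  then show "hproj dq e (lc r A w) t = lc r A (hproj dr e w) t"
    by (cases "dq t \<le> e") (simp_all add: hproj_def[of dq] lc_def hom_component_sum)
qed

lemma lift_rows:
  assumes B: "\<And>s. s < r \<Longrightarrow> B s \<in> hvec V q dq (dr s)"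
    and y: "\<And>s. s < m \<Longrightarrow> y s \<in> hvec V q dq (e s)"
    and im: "\<And>s. s < m \<Longrightarrow> y s \<in> lc r B ` free_module V r"
  shows "\<exists>X. \<forall>s<m. X s \<in> hvec V r dr (e s) \<and> lc r B (X s) = y s"
proof -
  have "\<exists>x. x \<in> hvec V r dr (e s) \<and> lc r B x = y s" if s: "s < m" for s
  proof -
    obtain u where u: "u \<in> free_module V r" "y s = lc r B u" using im[OF s] by auto
    have "lc r B (hproj dr (e s) u) = hproj dq (e s) (y s)"
      using hproj_lc[where A = B and dq = dq and dr = dr, OF B] u by simp
    then show ?thesis using hproj_hvec[OF u(1)] hproj_id[OF y[OF s]] by metis
  qed
  then show ?thesis by metis
qed

text \<open>Freeness of the source: it suffices to lift the images of the basis vectors through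
  \<open>B\<close>, and \<open>\<phi>'\<close> collects these lifts as its rows. Both the comparison
  of resolutions and the chain maps behind the mapping cones are built from this step.\<close>

lemma lift_step:
  assumes B: "\<And>s. s < r' \<Longrightarrow> B s \<in> hvec V q' dq' (dr' s)"
    and A: "\<And>s. s < r \<Longrightarrow> A s \<in> hvec V q dq (dr s)"
    and \<phi>: "\<And>s. s < q \<Longrightarrow> \<phi> s \<in> hvec V q' dq' (dq s)"
    and im: "\<And>z. z \<in> lc r A ` free_module V r \<Longrightarrow> lc q \<phi> z \<in> lc r' B ` free_module V r'"
  obtains \<phi>' where "\<And>s. s < r \<Longrightarrow> \<phi>' s \<in> hvec V r' dr' (dr s)"
    "\<And>w. lc r' B (lc r \<phi>' w) = lc q \<phi> (lc r A w)"
proof -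
  have A_im: "A s \<in> lc r A ` free_module V r" if "s < r" for s
    using lc_unit_vec[OF that] free_unit_vec[OF that] by (metis image_eqI)
  have "\<exists>X. \<forall>s<r. X s \<in> hvec V r' dr' (dr s) \<and> lc r' B (X s) = lc q \<phi> (A s)"
    by (rule lift_rows[OF B]) (auto intro!: lc_hvec[OF \<phi>] A im A_im)
  then obtain X where X: "\<And>s. s < r \<Longrightarrow> X s \<in> hvec V r' dr' (dr s)"
      "\<And>s. s < r \<Longrightarrow> lc r' B (X s) = lc q \<phi> (A s)" by blast
  show thesis
  proof
    show "lc r' B (lc r X w) = lc q \<phi> (lc r A w)" for w
      unfolding lc_lc by (rule lc_cong) (rule X(2))
  qed (rule X(1))
qed

section \<open>Uniqueness of graded Betti numbers\<close>

text \<open>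
  A minimal graded free resolution of \<open>R/J\<close>; the matrix \<open>A i\<close> belongs to \<open>F_(i+1) \<rightarrow> F_i\<close>, and
  \<open>F_0 \<rightarrow> R/J\<close> is represented by a map \<open>F_0 \<rightarrow> R\<close> whose matrix has the single column \<open>f\<close>.
\<close>

definition column :: "(nat \<Rightarrow> ('v, 'k::field) mpoly) \<Rightarrow> nat \<Rightarrow> nat \<Rightarrow> ('v, 'k) mpoly" where
  "column f s t = (if t = 0 then f s else 0)"

definition gres :: "'v set \<Rightarrow> ('v, 'k::field) mpoly set \<Rightarrow> (nat \<Rightarrow> nat) \<Rightarrow> (nat \<Rightarrow> nat \<Rightarrow> nat) \<Rightarrow>
    (nat \<Rightarrow> ('v, 'k) mpoly) \<Rightarrow> (nat \<Rightarrow> nat \<Rightarrow> nat \<Rightarrow> ('v, 'k) mpoly) \<Rightarrow> bool" where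
  "gres V J r d f A \<longleftrightarrow>
     (\<forall>s < r 0. f s \<in> homogeneous_part V (d 0 s)) \<and>
     (\<forall>i. \<forall>s < r (Suc i). A i s \<in> hvec V (r i) (d i) (d (Suc i) s)) \<and>
     (\<forall>p \<in> pols V. \<exists>w \<in> free_module V (r 0). p - lc (r 0) (column f) w 0 \<in> J) \<and>
     {w \<in> free_module V (r 0). lc (r 0) (column f) w 0 \<in> J} = lc (r (Suc 0)) (A 0) ` free_module V (r (Suc 0)) \<and>
     (\<forall>i. {w \<in> free_module V (r (Suc i)). lc (r (Suc i)) (A i) w = (\<lambda>_. 0)} =
          lc (r (Suc (Suc i))) (A (Suc i)) ` free_module V (r (Suc (Suc i)))) \<and>
     (\<forall>i. \<forall>s < r (Suc i). \<forall>t. const_term (A i s t) = 0)"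

lemma gresD:
  assumes "gres V J r d f A"
  shows "\<And>s. s < r 0 \<Longrightarrow> f s \<in> homogeneous_part V (d 0 s)"
    and "\<And>i s. s < r (Suc i) \<Longrightarrow> A i s \<in> hvec V (r i) (d i) (d (Suc i) s)"
    and "\<And>p. p \<in> pols V \<Longrightarrow> \<exists>w \<in> free_module V (r 0). p - lc (r 0) (column f) w 0 \<in> J"
    and "{w \<in> free_module V (r 0). lc (r 0) (column f) w 0 \<in> J} = lc (r (Suc 0)) (A 0) ` free_module V (r (Suc 0))"
    and "\<And>i. {w \<in> free_module V (r (Suc i)). lc (r (Suc i)) (A i) w = (\<lambda>_. 0)} =
          lc (r (Suc (Suc i))) (A (Suc i)) ` free_module V (r (Suc (Suc i)))"
    and "\<And>i s t. s < r (Suc i) \<Longrightarrow> const_term (A i s t) = 0"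
  using assms unfolding gres_def by simp_all

lemma column_hvec: "f s \<in> homogeneous_part V e \<Longrightarrow> column f s \<in> hvec V 1 (\<lambda>_. 0) e"
  by (auto simp: hvec_def column_def free_module_def homogeneous_pols)

text \<open>
  Comparison of resolutions: the component \<open>\<phi>\<close> in degree \<open>i\<close> of a chain map between the two
  resolutions and \<open>\<psi>\<close> of one in the opposite direction. The last map \<open>h\<close> of a homotopy from
  \<open>\<psi>\<phi>\<close> to the identity is recorded only on the cycles, where its predecessor does not contribute;
  minimality of the resolution turns the homotopy into \<open>\<psi>\<phi> \<equiv> 1\<close> modulo the irrelevant ideal.
\<close>

definition comparison :: "'v set \<Rightarrow>
    (nat \<Rightarrow> nat) \<Rightarrow> (nat \<Rightarrow> nat \<Rightarrow> nat) \<Rightarrow> (nat \<Rightarrow> nat \<Rightarrow> nat \<Rightarrow> ('v, 'k::field) mpoly) \<Rightarrow>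
    (nat \<Rightarrow> nat) \<Rightarrow> (nat \<Rightarrow> nat \<Rightarrow> nat) \<Rightarrow> (nat \<Rightarrow> nat \<Rightarrow> nat \<Rightarrow> ('v, 'k) mpoly) \<Rightarrow> nat \<Rightarrow>
    (nat \<Rightarrow> nat \<Rightarrow> ('v, 'k) mpoly) \<Rightarrow> (nat \<Rightarrow> nat \<Rightarrow> ('v, 'k) mpoly) \<Rightarrow> (nat \<Rightarrow> nat \<Rightarrow> ('v, 'k) mpoly) \<Rightarrow> bool" where
  "comparison V r d A r' d' A' i \<phi> \<psi> h \<longleftrightarrow>
     (\<forall>s < r i. \<phi> s \<in> hvec V (r' i) (d' i) (d i s)) \<and>
     (\<forall>s < r' i. \<psi> s \<in> hvec V (r i) (d i) (d' i s)) \<and>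
     (\<forall>z \<in> lc (r (Suc i)) (A i) ` free_module V (r (Suc i)).
        lc (r i) \<phi> z \<in> lc (r' (Suc i)) (A' i) ` free_module V (r' (Suc i))) \<and>
     (\<forall>z \<in> lc (r' (Suc i)) (A' i) ` free_module V (r' (Suc i)).
        lc (r' i) \<psi> z \<in> lc (r (Suc i)) (A i) ` free_module V (r (Suc i))) \<and>
     (\<forall>s < r i. h s \<in> free_module V (r (Suc i))) \<and>
     (\<forall>z \<in> lc (r (Suc i)) (A i) ` free_module V (r (Suc i)).
        lc (r' i) \<psi> (lc (r i) \<phi> z) = (\<lambda>t. z t + lc (r (Suc i)) (A i) (lc (r i) h z) t)) \<and>
     (\<forall>s < r i. \<forall>t. const_term (lc (r' i) \<psi> (\<phi> s) t) = (if s = t then 1 else 0))"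

context
  fixes V :: "'v set" and J :: "('v, 'k::field) mpoly set" and U
  assumes U: "upset U" and J: "J = mon_ideal V U"
begin

text \<open>A monomial ideal contains the homogeneous components of its elements, so projecting a
  lift to degree \<open>e\<close> keeps the error in \<open>J\<close>.\<close>

lemma gres_lift_generator:
  assumes g: "gres V J r d f A" and p: "p \<in> homogeneous_part V e"
  shows "\<exists>w \<in> hvec V (r 0) (d 0) e. p - lc (r 0) (column f) w 0 \<in> J"
proof -
  obtain w where w: "w \<in> free_module V (r 0)" "p - lc (r 0) (column f) w 0 \<in> J"
    using gresD(3)[OF g homogeneous_pols[OF p]] by blast
  have cols: "column f s \<in> hvec V 1 (\<lambda>_. 0) (d 0 s)" if "s < r 0" for s
    using gresD(1)[OF g that] by (rule column_hvec)
  have "lc (r 0) (column f) (hproj (d 0) e w) = hproj (\<lambda>_. 0) e (lc (r 0) (column f) w)"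
    by (rule hproj_lc[symmetric]) (rule cols)
  then have "p - lc (r 0) (column f) (hproj (d 0) e w) 0 = hom_component e (p - lc (r 0) (column f) w 0)"
    by (simp add: hproj_def[of "\<lambda>_. 0"] hom_component_diff hom_component_id[OF p])
  then show ?thesis
    using hproj_hvec[OF w(1)] mon_ideal_hom_component w(2) unfolding J by metis
qed

lemma lc_cong_ideal:
  assumes "\<And>s. s < r \<Longrightarrow> a s t - b s t \<in> J" "w \<in> free_module V r"
  shows "lc r a w t - lc r b w t \<in> J"
proof -
  have "lc r a w t - lc r b w t = (\<Sum>s<r. w s * (a s t - b s t))"
    by (simp add: lc_def sum_subtractf algebra_simps)
  moreover have "\<dots> \<in> J"
    unfolding J by (rule mon_ideal_sum)
      (use assms U in \<open>auto simp: J intro!: mon_ideal_mult free_pols\<close>)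
  ultimately show ?thesis by simp
qed

text \<open>The comparison theorem for resolutions. In degree 0 the generators are lifted modulo
  \<open>J\<close>; afterwards \<open>lift_step\<close> extends both chain maps, and exactness
  provides the homotopy.\<close>

lemma gres_compare:
  assumes g: "gres V J r d f A" and g': "gres V J r' d' f' A'"
  shows "\<exists>\<phi> \<psi> h. comparison V r d A r' d' A' i \<phi> \<psi> h"
proof (induction i)
  case 0
  note ex0 = gresD(4)[OF g]
  note ex0' = gresD(4)[OF g']
  have "\<exists>w. w \<in> hvec V (r' 0) (d' 0) (d 0 s) \<and> f s - lc (r' 0) (column f') w 0 \<in> J" if "s < r 0" for s
  proof -
    have "f s \<in> homogeneous_part V (d 0 s)" by (rule gresD(1)[OF g that])
    from gres_lift_generator[OF g' this] show ?thesis by blast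
  qed
  then obtain \<phi> where \<phi>: "\<And>s. s < r 0 \<Longrightarrow> \<phi> s \<in> hvec V (r' 0) (d' 0) (d 0 s)"
    "\<And>s. s < r 0 \<Longrightarrow> f s - lc (r' 0) (column f') (\<phi> s) 0 \<in> J" by metis
  have "\<exists>w. w \<in> hvec V (r 0) (d 0) (d' 0 s) \<and> f' s - lc (r 0) (column f) w 0 \<in> J" if "s < r' 0" for s
  proof -
    have "f' s \<in> homogeneous_part V (d' 0 s)" by (rule gresD(1)[OF g' that])
    from gres_lift_generator[OF g this] show ?thesis by blast
  qed
  then obtain \<psi> where \<psi>: "\<And>s. s < r' 0 \<Longrightarrow> \<psi> s \<in> hvec V (r 0) (d 0) (d' 0 s)"
    "\<And>s. s < r' 0 \<Longrightarrow> f' s - lc (r 0) (column f) (\<psi> s) 0 \<in> J" by metis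
  have \<phi>J: "lc (r 0) (column f) w 0 - lc (r' 0) (column f') (lc (r 0) \<phi> w) 0 \<in> J"
    if "w \<in> free_module V (r 0)" for w
    unfolding lc_lc using that by (intro lc_cong_ideal) (simp_all add: \<phi>(2) column_def[of f])
  have \<psi>J: "lc (r' 0) (column f') w 0 - lc (r 0) (column f) (lc (r' 0) \<psi> w) 0 \<in> J"
    if "w \<in> free_module V (r' 0)" for w
    unfolding lc_lc using that by (intro lc_cong_ideal) (simp_all add: \<psi>(2) column_def[of f'])
  have \<phi>_free: "lc (r 0) \<phi> w \<in> free_module V (r' 0)" if "w \<in> free_module V (r 0)" for w
    by (rule lc_free) (use \<phi> that hvec_free in blast)+
  have \<psi>_free: "lc (r' 0) \<psi> w \<in> free_module V (r 0)" if "w \<in> free_module V (r' 0)" for w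
    by (rule lc_free) (use \<psi> that hvec_free in blast)+
  have \<phi>Z: "lc (r 0) \<phi> z \<in> lc (r' (Suc 0)) (A' 0) ` free_module V (r' (Suc 0))"
    if "z \<in> lc (r (Suc 0)) (A 0) ` free_module V (r (Suc 0))" for z
  proof -
    have z: "z \<in> free_module V (r 0)" "lc (r 0) (column f) z 0 \<in> J" using that ex0 by auto
    then have "lc (r' 0) (column f') (lc (r 0) \<phi> z) 0 \<in> J"
      using mon_ideal_diff[OF z(2)[unfolded J] \<phi>J[OF z(1), unfolded J]] by (simp add: J)
    then show ?thesis using \<phi>_free[OF z(1)] ex0' by blast
  qed
  have \<psi>Z: "lc (r' 0) \<psi> z \<in> lc (r (Suc 0)) (A 0) ` free_module V (r (Suc 0))"
    if "z \<in> lc (r' (Suc 0)) (A' 0) ` free_module V (r' (Suc 0))" for z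
  proof -
    have z: "z \<in> free_module V (r' 0)" "lc (r' 0) (column f') z 0 \<in> J" using that ex0' by auto
    then have "lc (r 0) (column f) (lc (r' 0) \<psi> z) 0 \<in> J"
      using mon_ideal_diff[OF z(2)[unfolded J] \<psi>J[OF z(1), unfolded J]] by (simp add: J)
    then show ?thesis using \<psi>_free[OF z(1)] ex0 by blast
  qed
  have "\<exists>x. x \<in> free_module V (r (Suc 0)) \<and> (\<lambda>t. lc (r' 0) \<psi> (\<phi> s) t - unit_vec s t) = lc (r (Suc 0)) (A 0) x"
    if s: "s < r 0" for s
  proof -
    \<comment> \<open>Both maps respect the augmentations modulo \<open>J\<close>, so this
      difference augments into \<open>J\<close>; exactness at \<open>F_0\<close> makes it a
      boundary, whose preimage is the row \<open>h s\<close>.\<close>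
    let ?v = "\<lambda>t. lc (r' 0) \<psi> (\<phi> s) t - unit_vec s t"
    have \<phi>s: "\<phi> s \<in> free_module V (r' 0)" using \<phi>(1)[OF s] by (rule hvec_free)
    have 1: "lc (r 0) (column f) ?v 0 = lc (r 0) (column f) (lc (r' 0) \<psi> (\<phi> s)) 0 - f s"
      by (simp add: lc_diff lc_unit_vec[OF s]) (simp add: column_def)
    have "f s - lc (r' 0) (column f') (\<phi> s) 0
        + (lc (r' 0) (column f') (\<phi> s) 0 - lc (r 0) (column f) (lc (r' 0) \<psi> (\<phi> s)) 0) \<in> J"
      using mon_ideal_add \<phi>(2)[OF s] \<psi>J[OF \<phi>s] unfolding J by blast
    then have "- lc (r 0) (column f) ?v 0 \<in> J" unfolding 1 by simp
    then have "lc (r 0) (column f) ?v 0 \<in> J"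
      using mon_ideal_uminus unfolding J by fastforce
    moreover have "?v \<in> free_module V (r 0)"
      by (intro free_diff \<psi>_free \<phi>s free_unit_vec s)
    ultimately show ?thesis using ex0 by blast
  qed
  then obtain h where h: "\<And>s. s < r 0 \<Longrightarrow> h s \<in> free_module V (r (Suc 0))"
    "\<And>s. s < r 0 \<Longrightarrow> (\<lambda>t. lc (r' 0) \<psi> (\<phi> s) t - unit_vec s t) = lc (r (Suc 0)) (A 0) (h s)" by metis
  have \<psi>\<phi>: "lc (r' 0) \<psi> (\<phi> s) = (\<lambda>t. unit_vec s t + lc (r (Suc 0)) (A 0) (h s) t)" if "s < r 0" for s
    unfolding h(2)[OF that, symmetric] by simp
  have hom: "lc (r' 0) \<psi> (lc (r 0) \<phi> z) = (\<lambda>t. z t + lc (r (Suc 0)) (A 0) (lc (r 0) h z) t)"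
    if "z \<in> lc (r (Suc 0)) (A 0) ` free_module V (r (Suc 0))" for z
  proof -
    have "z \<in> free_module V (r 0)" using that ex0 by auto
    moreover have "lc (r' 0) \<psi> (lc (r 0) \<phi> z) = lc (r 0) (\<lambda>s t. unit_vec s t + lc (r (Suc 0)) (A 0) (h s) t) z"
      unfolding lc_lc by (rule lc_cong) (rule \<psi>\<phi>)
    ultimately show ?thesis by (simp add: lc_rows_add lc_unit_rows lc_lc)
  qed
  have const: "const_term (lc (r' 0) \<psi> (\<phi> s) t) = (if s = t then 1 else 0)" if "s < r 0" for s t
  proof -
    \<comment> \<open>Minimality: all entries of \<open>A 0\<close> vanish at the origin, and hence
      so does the homotopy term.\<close>
    have "const_term (lc (r (Suc 0)) (A 0) (h s) t) = 0"
      by (simp add: lc_def const_term_sum gresD(6)[OF g])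
    then show ?thesis using \<psi>\<phi>[OF that] by (auto simp: unit_vec_def)
  qed
  show ?case
    unfolding comparison_def
    by (intro exI[of _ \<phi>] exI[of _ \<psi>] exI[of _ h] conjI allI ballI impI;
        rule \<phi>(1) \<psi>(1) \<phi>Z \<psi>Z h(1) hom const; assumption)
next
  case (Suc i)
  then obtain \<phi> \<psi> h where C: "comparison V r d A r' d' A' i \<phi> \<psi> h" by blast
  note C = C[unfolded comparison_def]
  have \<phi>: "\<And>s. s < r i \<Longrightarrow> \<phi> s \<in> hvec V (r' i) (d' i) (d i s)"
    using C[THEN conjunct1] by blast
  have \<psi>: "\<And>s. s < r' i \<Longrightarrow> \<psi> s \<in> hvec V (r i) (d i) (d' i s)"
    using C[THEN conjunct2, THEN conjunct1] by blast
  have \<phi>Z: "\<And>z. z \<in> lc (r (Suc i)) (A i) ` free_module V (r (Suc i)) \<Longrightarrow>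
        lc (r i) \<phi> z \<in> lc (r' (Suc i)) (A' i) ` free_module V (r' (Suc i))"
    using C[THEN conjunct2, THEN conjunct2, THEN conjunct1] by blast
  have \<psi>Z: "\<And>z. z \<in> lc (r' (Suc i)) (A' i) ` free_module V (r' (Suc i)) \<Longrightarrow>
        lc (r' i) \<psi> z \<in> lc (r (Suc i)) (A i) ` free_module V (r (Suc i))"
    using C[THEN conjunct2, THEN conjunct2, THEN conjunct2, THEN conjunct1] by blast
  have h: "\<And>s. s < r i \<Longrightarrow> h s \<in> free_module V (r (Suc i))"
    using C[THEN conjunct2, THEN conjunct2, THEN conjunct2, THEN conjunct2, THEN conjunct1] by blast
  have hom: "\<And>z. z \<in> lc (r (Suc i)) (A i) ` free_module V (r (Suc i)) \<Longrightarrow>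
        lc (r' i) \<psi> (lc (r i) \<phi> z) = (\<lambda>t. z t + lc (r (Suc i)) (A i) (lc (r i) h z) t)"
    using C[THEN conjunct2, THEN conjunct2, THEN conjunct2, THEN conjunct2, THEN conjunct2, THEN conjunct1] by blast
  let ?Z = "lc (r (Suc (Suc i))) (A (Suc i)) ` free_module V (r (Suc (Suc i)))"
  let ?Z' = "lc (r' (Suc (Suc i))) (A' (Suc i)) ` free_module V (r' (Suc (Suc i)))"
  have A: "A i s \<in> hvec V (r i) (d i) (d (Suc i) s)" if "s < r (Suc i)" for i s
    by (rule gresD(2)[OF g that])
  have A': "A' i s \<in> hvec V (r' i) (d' i) (d' (Suc i) s)" if "s < r' (Suc i)" for i s
    by (rule gresD(2)[OF g' that])
  have ex: "{w \<in> free_module V (r (Suc i)). lc (r (Suc i)) (A i) w = (\<lambda>_. 0)} = ?Z"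
    by (rule gresD(5)[OF g])
  have ex': "{w \<in> free_module V (r' (Suc i)). lc (r' (Suc i)) (A' i) w = (\<lambda>_. 0)} = ?Z'"
    by (rule gresD(5)[OF g'])
  obtain \<phi>' where \<phi>': "\<And>s. s < r (Suc i) \<Longrightarrow> \<phi>' s \<in> hvec V (r' (Suc i)) (d' (Suc i)) (d (Suc i) s)"
    "\<And>w. lc (r' (Suc i)) (A' i) (lc (r (Suc i)) \<phi>' w) = lc (r i) \<phi> (lc (r (Suc i)) (A i) w)"
    using lift_step[of "r' (Suc i)" "A' i" V "r' i" "d' i" "d' (Suc i)" "r (Suc i)" "A i" "r i" "d i" "d (Suc i)" \<phi>,
        OF A' A \<phi> \<phi>Z] by blast
  obtain \<psi>' where \<psi>': "\<And>s. s < r' (Suc i) \<Longrightarrow> \<psi>' s \<in> hvec V (r (Suc i)) (d (Suc i)) (d' (Suc i) s)"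
    "\<And>w. lc (r (Suc i)) (A i) (lc (r' (Suc i)) \<psi>' w) = lc (r' i) \<psi> (lc (r' (Suc i)) (A' i) w)"
    using lift_step[of "r (Suc i)" "A i" V "r i" "d i" "d (Suc i)" "r' (Suc i)" "A' i" "r' i" "d' i" "d' (Suc i)" \<psi>,
        OF A A' \<psi> \<psi>Z] by blast
  have \<phi>_free: "lc (r (Suc i)) \<phi>' w \<in> free_module V (r' (Suc i))" if "w \<in> free_module V (r (Suc i))" for w
    by (rule lc_free) (use \<phi>' that hvec_free in blast)+
  have \<psi>_free: "lc (r' (Suc i)) \<psi>' w \<in> free_module V (r (Suc i))" if "w \<in> free_module V (r' (Suc i))" for w
    by (rule lc_free) (use \<psi>' that hvec_free in blast)+
  have \<phi>Z': "lc (r (Suc i)) \<phi>' z \<in> ?Z'" if "z \<in> ?Z" for z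
  proof -
    have z: "z \<in> free_module V (r (Suc i))" "lc (r (Suc i)) (A i) z = (\<lambda>_. 0)" using that ex by auto
    have "lc (r (Suc i)) \<phi>' z \<in> {w \<in> free_module V (r' (Suc i)). lc (r' (Suc i)) (A' i) w = (\<lambda>_. 0)}"
      using z \<phi>_free[OF z(1)] by (simp add: \<phi>'(2))
    then show ?thesis unfolding ex' .
  qed
  have \<psi>Z': "lc (r' (Suc i)) \<psi>' z \<in> ?Z" if "z \<in> ?Z'" for z
  proof -
    have z: "z \<in> free_module V (r' (Suc i))" "lc (r' (Suc i)) (A' i) z = (\<lambda>_. 0)" using that ex' by auto
    have "lc (r' (Suc i)) \<psi>' z \<in> {w \<in> free_module V (r (Suc i)). lc (r (Suc i)) (A i) w = (\<lambda>_. 0)}"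
      using z \<psi>_free[OF z(1)] by (simp add: \<psi>'(2))
    then show ?thesis unfolding ex .
  qed
  have A_im: "A i s \<in> lc (r (Suc i)) (A i) ` free_module V (r (Suc i))" if "s < r (Suc i)" for s
    using lc_unit_vec[OF that] free_unit_vec[OF that] by (metis image_eqI)
  have "\<exists>x. x \<in> free_module V (r (Suc (Suc i))) \<and>
      (\<lambda>t. lc (r' (Suc i)) \<psi>' (\<phi>' s) t - (unit_vec s t + lc (r i) h (A i s) t))
        = lc (r (Suc (Suc i))) (A (Suc i)) x"
    if s: "s < r (Suc i)" for s
  proof -
    \<comment> \<open>The homotopy equation with its unknown term left out. It is a cycle, because
      the homotopy relation \<open>hom\<close> of the previous degree applies to the boundary
      \<open>A i s\<close>.\<close>
    let ?v = "\<lambda>t. lc (r' (Suc i)) \<psi>' (\<phi>' s) t - (unit_vec s t + lc (r i) h (A i s) t)"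
    have \<phi>s: "\<phi>' s \<in> free_module V (r' (Suc i))" using \<phi>'(1)[OF s] by (rule hvec_free)
    have "lc (r' (Suc i)) (A' i) (\<phi>' s) = lc (r i) \<phi> (A i s)"
      using \<phi>'(2)[of "unit_vec s"] by (simp add: lc_unit_vec[OF s])
    then have "lc (r (Suc i)) (A i) ?v = (\<lambda>_. 0)"
      by (simp add: lc_diff lc_add lc_unit_vec[OF s] \<psi>'(2) hom[OF A_im[OF s]])
    moreover have "?v \<in> free_module V (r (Suc i))"
      by (intro free_diff free_add \<psi>_free \<phi>s free_unit_vec s lc_free[OF h] hvec_free[OF A])
    ultimately show ?thesis using ex by blast
  qed
  then have "\<forall>s. \<exists>x. s < r (Suc i) \<longrightarrow> x \<in> free_module V (r (Suc (Suc i))) \<and>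
      (\<lambda>t. lc (r' (Suc i)) \<psi>' (\<phi>' s) t - (unit_vec s t + lc (r i) h (A i s) t))
        = lc (r (Suc (Suc i))) (A (Suc i)) x" by blast
  from choice[OF this] obtain h' where h': "\<And>s. s < r (Suc i) \<Longrightarrow> h' s \<in> free_module V (r (Suc (Suc i)))"
    "\<And>s. s < r (Suc i) \<Longrightarrow> (\<lambda>t. lc (r' (Suc i)) \<psi>' (\<phi>' s) t - (unit_vec s t + lc (r i) h (A i s) t))
        = lc (r (Suc (Suc i))) (A (Suc i)) (h' s)" by blast
  have \<psi>\<phi>: "lc (r' (Suc i)) \<psi>' (\<phi>' s)
      = (\<lambda>t. unit_vec s t + lc (r i) h (A i s) t + lc (r (Suc (Suc i))) (A (Suc i)) (h' s) t)"
    if "s < r (Suc i)" for s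
    unfolding h'(2)[OF that, symmetric] by simp
  have hom': "lc (r' (Suc i)) \<psi>' (lc (r (Suc i)) \<phi>' z)
      = (\<lambda>t. z t + lc (r (Suc (Suc i))) (A (Suc i)) (lc (r (Suc i)) h' z) t)" if "z \<in> ?Z" for z
  proof -
    have z: "z \<in> free_module V (r (Suc i))" "lc (r (Suc i)) (A i) z = (\<lambda>_. 0)" using that ex by auto
    have "lc (r' (Suc i)) \<psi>' (lc (r (Suc i)) \<phi>' z) = lc (r (Suc i)) (\<lambda>s t. unit_vec s t
        + lc (r i) h (A i s) t + lc (r (Suc (Suc i))) (A (Suc i)) (h' s) t) z"
      unfolding lc_lc by (rule lc_cong) (rule \<psi>\<phi>)
    then show ?thesis
      using z by (simp add: lc_rows_add lc_unit_rows lc_lc[symmetric])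
  qed
  have const: "const_term (lc (r' (Suc i)) \<psi>' (\<phi>' s) t) = (if s = t then 1 else 0)"
    if "s < r (Suc i)" for s t
  proof -
    \<comment> \<open>Two homotopy terms occur here, one through the rows of
      \<open>A (Suc i)\<close> and one through those of \<open>A i\<close>; minimality kills the
      constant terms of both.\<close>
    have "const_term (lc (r (Suc (Suc i))) (A (Suc i)) (h' s) t) = 0"
      by (simp add: lc_def const_term_sum gresD(6)[OF g])
    moreover have "const_term (lc (r i) h (A i s) t) = 0"
      by (simp add: lc_def const_term_sum gresD(6)[OF g that])
    ultimately show ?thesis using \<psi>\<phi>[OF that] by (auto simp: unit_vec_def)
  qed
  show ?case
    unfolding comparison_def
    by (intro exI[of _ \<phi>'] exI[of _ \<psi>'] exI[of _ h'] conjI allI ballI impI;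
        rule \<phi>'(1) \<psi>'(1) \<phi>Z' \<psi>Z' h'(1) hom' const; assumption)
qed

end

section \<open>Linear algebra over the field and equality of ranks\<close>

lemma underdetermined_system:
  fixes a :: "'a \<Rightarrow> 'b \<Rightarrow> 'k::field"
  assumes "finite T" "finite S" "card T < card S"
  shows "\<exists>x. (\<exists>s\<in>S. x s \<noteq> 0) \<and> (\<forall>t\<in>T. (\<Sum>s\<in>S. x s * a s t) = 0)"
  using assms
proof (induction T arbitrary: S a rule: finite_induct)
  case empty
  then have "S \<noteq> {}" by auto
  then show ?case by (intro exI[of _ "\<lambda>_. 1"]) auto
next
  case (insert t T)
  show ?case
  proof (cases "\<exists>u\<in>S. a u t \<noteq> 0")
    case False
    then obtain x where "\<exists>s\<in>S. x s \<noteq> 0" "\<forall>t\<in>T. (\<Sum>s\<in>S. x s * a s t) = 0"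
      using insert.IH[of S a] insert.prems insert.hyps by auto
    then show ?thesis using False by (intro exI[of _ x]) auto
  next
    case True
    then obtain u where u: "u \<in> S" "a u t \<noteq> 0" by blast
    let ?S = "S - {u}"
    \<comment> \<open>Equation \<open>t\<close> is solved for the unknown at the pivot
      \<open>u\<close>, giving it the value \<open>- c\<close> below; \<open>?b\<close> is the
      system that remains after substitution.\<close>
    let ?b = "\<lambda>s t'. a s t' - a s t / a u t * a u t'"
    have "card T < card ?S" using insert u by (simp add: card_Diff_singleton)
    then obtain x where x: "\<exists>s\<in>?S. x s \<noteq> 0" "\<forall>t'\<in>T. (\<Sum>s\<in>?S. x s * ?b s t') = 0"
      using insert.IH[of ?S ?b] insert.prems by auto
    define c where "c = (\<Sum>s\<in>?S. x s * a s t) / a u t"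
    let ?x = "\<lambda>s. if s = u then - c else x s"
    have split: "(\<Sum>s\<in>S. ?x s * a s t') = (\<Sum>s\<in>?S. x s * a s t') - c * a u t'" for t'
    proof -
      have "(\<Sum>s\<in>S. ?x s * a s t') = ?x u * a u t' + (\<Sum>s\<in>?S. ?x s * a s t')"
        using u insert.prems by (simp add: sum.remove)
      also have "(\<Sum>s\<in>?S. ?x s * a s t') = (\<Sum>s\<in>?S. x s * a s t')" by (rule sum.cong) auto
      finally show ?thesis by simp
    qed
    have "(\<Sum>s\<in>?S. x s * ?b s t') = (\<Sum>s\<in>?S. x s * a s t') - c * a u t'" for t'
      by (simp add: c_def algebra_simps sum_subtractf sum_divide_distrib sum_distrib_left sum_distrib_right)
    then have "(\<Sum>s\<in>S. ?x s * a s t') = 0" if "t' \<in> T" for t'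
      using x(2) that by (simp only: split)
    moreover have "(\<Sum>s\<in>S. ?x s * a s t) = 0" unfolding split unfolding c_def using u by simp
    moreover have "\<exists>s\<in>S. ?x s \<noteq> 0" using x(1) by auto
    ultimately show ?thesis by (intro exI[of _ ?x]) blast
  qed
qed

text \<open>If \<open>S\<close> were larger than \<open>T\<close>, some nonzero row vector would be
  annihilated by \<open>a\<close>, hence also by the product of \<open>a\<close> and
  \<open>b\<close>, which is the identity.\<close>

lemma card_le_left_inverse:
  fixes a b :: "_ \<Rightarrow> _ \<Rightarrow> 'k::field"
  assumes fin: "finite S" "finite T"
    and inv: "\<And>s s'. s \<in> S \<Longrightarrow> s' \<in> S \<Longrightarrow> (\<Sum>t\<in>T. a s t * b t s') = (if s = s' then 1 else 0)"
  shows "card S \<le> card T"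
proof (rule ccontr)
  assume "\<not> card S \<le> card T"
  then obtain x where x: "\<exists>s\<in>S. x s \<noteq> 0" "\<forall>t\<in>T. (\<Sum>s\<in>S. x s * a s t) = 0"
    using underdetermined_system[OF fin(2,1), of a] by auto
  have "x s' = 0" if "s' \<in> S" for s'
  proof -
    have "x s' = (\<Sum>s\<in>S. x s * (if s = s' then 1 else 0))"
      using that fin by (simp add: if_distrib cong: if_cong)
    also have "\<dots> = (\<Sum>s\<in>S. x s * (\<Sum>t\<in>T. a s t * b t s'))"
      by (rule sum.cong) (use that inv in auto)
    also have "\<dots> = (\<Sum>t\<in>T. (\<Sum>s\<in>S. x s * a s t) * b t s')"
      unfolding sum_distrib_left sum_distrib_right by (subst sum.swap) (simp add: mult.assoc)
    finally show ?thesis using x(2) by simp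
  qed
  then show False using x(1) by blast
qed

text \<open>At the origin the composition of \<open>\<phi>\<close> and \<open>\<psi>\<close> becomes
  an identity matrix over the field. As the maps preserve degrees, its block of degree
  \<open>j\<close> factors through the basis vectors of degree \<open>j\<close> of the other
  resolution. Exchanging the resolutions gives the reverse inequality.\<close>

lemma gres_betti_le:
  assumes U: "upset U" and J: "J = mon_ideal V U"
    and g: "gres V J r d f A" and g': "gres V J r' d' f' A'"
  shows "card {s. s < r i \<and> d i s = j} \<le> card {s. s < r' i \<and> d' i s = j}"
proof -
  obtain \<phi> \<psi> h where C: "comparison V r d A r' d' A' i \<phi> \<psi> h"
    using gres_compare[OF U J g g'] by blast
  note C = C[unfolded comparison_def]
  have \<phi>: "\<And>s. s < r i \<Longrightarrow> \<phi> s \<in> hvec V (r' i) (d' i) (d i s)"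
    using C[THEN conjunct1] by blast
  have c: "\<And>s t. s < r i \<Longrightarrow> const_term (lc (r' i) \<psi> (\<phi> s) t) = (if s = t then 1 else 0)"
    using C[THEN conjunct2, THEN conjunct2, THEN conjunct2, THEN conjunct2, THEN conjunct2, THEN conjunct2] by blast
  let ?T = "{s. s < r' i \<and> d' i s = j}"
  show ?thesis
  proof (rule card_le_left_inverse[where a = "\<lambda>s t. const_term (\<phi> s t)" and b = "\<lambda>t s. const_term (\<psi> t s)"])
    fix s s' assume s: "s \<in> {s. s < r i \<and> d i s = j}" "s' \<in> {s. s < r i \<and> d i s = j}"
    \<comment> \<open>A nonzero entry between different degrees is homogeneous of positive degree,
      so only the basis vectors of degree \<open>j\<close> contribute to the sum.\<close>
    have "const_term (\<phi> s t) = 0" if "t < r' i" "d' i t \<noteq> j" for t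
    proof (cases "\<phi> s t = 0")
      case False
      then have "d' i t \<le> d i s" "\<phi> s t \<in> homogeneous_part V (d i s - d' i t)"
        using \<phi>[of s] s by (auto simp: hvec_def)
      then show ?thesis using that s by (intro const_term_homogeneous) auto
    qed simp
    then have "(\<Sum>t\<in>?T. const_term (\<phi> s t) * const_term (\<psi> t s'))
        = (\<Sum>t<r' i. const_term (\<phi> s t) * const_term (\<psi> t s'))"
      by (intro sum.mono_neutral_left) auto
    also have "\<dots> = const_term (lc (r' i) \<psi> (\<phi> s) s')" by (simp add: lc_def const_term_sum)
    finally show "(\<Sum>t\<in>?T. const_term (\<phi> s t) * const_term (\<psi> t s')) = (if s = s' then 1 else 0)"
      using c s by auto
  qed auto
qed

section \<open>Pure resolutions and mapping cones\<close>

text \<open>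
  A graded free resolution of \<open>R/J\<close> with \<open>F_0 = R\<close> all of whose basis vectors in homological
  degree \<open>i\<close> have the same degree \<open>\<delta> i\<close>.
\<close>

definition pure_res :: "'v set \<Rightarrow> ('v, 'k::field) mpoly set \<Rightarrow> (nat \<Rightarrow> nat) \<Rightarrow> (nat \<Rightarrow> nat) \<Rightarrow>
    (nat \<Rightarrow> nat \<Rightarrow> nat \<Rightarrow> ('v, 'k) mpoly) \<Rightarrow> bool" where
  "pure_res V J \<delta> r A \<longleftrightarrow> r 0 = 1 \<and>
     (\<forall>i. \<forall>s < r (Suc i). A i s \<in> hvec V (r i) (\<lambda>_. \<delta> i) (\<delta> (Suc i))) \<and>
     {w \<in> free_module V (r 0). w 0 \<in> J} = lc (r (Suc 0)) (A 0) ` free_module V (r (Suc 0)) \<and>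
     (\<forall>i. {w \<in> free_module V (r (Suc i)). lc (r (Suc i)) (A i) w = (\<lambda>_. 0)} =
          lc (r (Suc (Suc i))) (A (Suc i)) ` free_module V (r (Suc (Suc i))))"

lemma pure_resD:
  assumes "pure_res V J \<delta> r A"
  shows "r 0 = 1"
    and "\<And>i s. s < r (Suc i) \<Longrightarrow> A i s \<in> hvec V (r i) (\<lambda>_. \<delta> i) (\<delta> (Suc i))"
    and "{w \<in> free_module V (r 0). w 0 \<in> J} = lc (r (Suc 0)) (A 0) ` free_module V (r (Suc 0))"
    and "\<And>i. {w \<in> free_module V (r (Suc i)). lc (r (Suc i)) (A i) w = (\<lambda>_. 0)} =
          lc (r (Suc (Suc i))) (A (Suc i)) ` free_module V (r (Suc (Suc i)))"
  using assms[unfolded pure_res_def, THEN conjunct1]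
    assms[unfolded pure_res_def, THEN conjunct2, THEN conjunct1]
    assms[unfolded pure_res_def, THEN conjunct2, THEN conjunct2, THEN conjunct1]
    assms[unfolded pure_res_def, THEN conjunct2, THEN conjunct2, THEN conjunct2]
  by blast+

text \<open>Coordinates of a direct sum. It is polymorphic because it concatenates both vectors and
  lists of matrix rows.\<close>

definition join :: "nat \<Rightarrow> (nat \<Rightarrow> 'a) \<Rightarrow> (nat \<Rightarrow> 'a) \<Rightarrow> nat \<Rightarrow> 'a" where
  "join r a b = (\<lambda>s. if s < r then a s else b (s - r))"

lemma join_free: "a \<in> free_module V r \<Longrightarrow> b \<in> free_module V q \<Longrightarrow> join r a b \<in> free_module V (r + q)"
  by (auto simp: free_module_def join_def)

lemma join_cases:
  assumes "w \<in> free_module V (r + q)"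
  obtains a b where "a \<in> free_module V r" "b \<in> free_module V q" "w = join r a b"
proof
  show "(\<lambda>s. if s < r then w s else 0) \<in> free_module V r" "(\<lambda>s. w (r + s)) \<in> free_module V q"
    using assms by (auto simp: free_module_def)
  show "w = join r (\<lambda>s. if s < r then w s else 0) (\<lambda>s. w (r + s))"
    by (auto simp: join_def)
qed

lemma join_eq_0_iff:
  "a \<in> free_module V r \<Longrightarrow> join r a b = (\<lambda>_. 0) \<longleftrightarrow> a = (\<lambda>_. 0) \<and> b = (\<lambda>_. 0)"
proof (intro iffI conjI ext)
  fix t assume a: "a \<in> free_module V r" and j: "join r a b = (\<lambda>_. 0)"
  show "a t = 0" using fun_cong[OF j, of t] a by (cases "t < r") (auto simp: join_def free_module_def)
  show "b t = 0" using fun_cong[OF j, of "r + t"] by (simp add: join_def)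
qed (simp add: join_def)

lemma join_hvec:
  assumes "a \<in> hvec V r (\<lambda>_. e) d" "b \<in> hvec V q (\<lambda>_. e) d"
  shows "join r a b \<in> hvec V (r + q) (\<lambda>_. e) d"
  using assms join_free[of a V r b q] by (auto simp: hvec_def join_def)

lemma lc_join: "lc (r + q) (join r A B) (join r a b) = (\<lambda>t. lc r A a t + lc q B b t)"
proof
  fix t
  have "lc (r + q) (join r A B) (join r a b) t
      = (\<Sum>s<r. join r a b s * join r A B s t) + (\<Sum>s<q. join r a b (r + s) * join r A B (r + s) t)"
    unfolding lc_def by (induction q) (simp_all add: add.assoc)
  then show "lc (r + q) (join r A B) (join r a b) t = lc r A a t + lc q B b t"
    by (simp add: lc_def join_def)
qed

lemma lc_join_rows: "lc r (\<lambda>s. join n (A s) (B s)) w = join n (lc r A w) (lc r B w)"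
  by (auto simp: lc_def join_def)

lemma hvec_0 [simp]: "(\<lambda>_. 0) \<in> hvec V q d e"
  by (simp add: hvec_def)

lemma hvec_uminus: "w \<in> hvec V q d e \<Longrightarrow> (\<lambda>t. - w t) \<in> hvec V q d e"
  by (simp add: hvec_def free_uminus homogeneous_uminus)

text \<open>The twist by \<open>R(-c)\<close>, needed because multiplication by \<open>x\<close>
  raises degrees by \<open>c\<close>.\<close>

lemma hvec_shift: "w \<in> hvec V q (\<lambda>_. d) e \<Longrightarrow> w \<in> hvec V q (\<lambda>_. d + c) (e + c)"
  by (simp add: hvec_def)

lemma lc_rows_0 [simp]: "lc r (\<lambda>s t. 0) w = (\<lambda>_. 0)"
  by (simp add: lc_def)

lemma lc_rows_uminus: "lc r (\<lambda>s t. - A s t) w = (\<lambda>t. - lc r A w t)"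
  by (simp add: lc_def sum_negf)

text \<open>Since \<open>K\<close> is the colon ideal of \<open>J\<close> at \<open>x\<close>,
  multiplication by \<open>x\<close> is a well-defined map from \<open>R/K\<close> to
  \<open>R/J\<close>; it is lifted to the resolutions.\<close>

lemma chain_map_exists:
  assumes F: "pure_res V J \<delta> r A" and G: "pure_res V K \<delta>' r' A'"
    and x: "x \<in> homogeneous_part V c" and \<delta>0: "\<delta> 0 = 0" "\<delta>' 0 = 0"
    and colon: "\<And>p. p \<in> pols V \<Longrightarrow> p * x \<in> J \<longleftrightarrow> p \<in> K"
  shows "\<exists>\<phi>. \<phi> 0 0 = (\<lambda>t. if t = 0 then x else 0) \<and>
    (\<forall>i. \<forall>s < r' i. \<phi> i s \<in> hvec V (r i) (\<lambda>_. \<delta> i) (\<delta>' i + c)) \<and>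
    (\<forall>i w. lc (r (Suc i)) (A i) (lc (r' (Suc i)) (\<phi> (Suc i)) w) = lc (r' i) (\<phi> i) (lc (r' (Suc i)) (A' i) w))"
proof -
  \<comment> \<open>\<open>P\<close> records that boundaries go to boundaries, the hypothesis of
    \<open>lift_step\<close> for the next component; \<open>Q\<close> is the commuting square
    linking consecutive choices.\<close>
  define P where "P i \<phi> \<longleftrightarrow> (i = 0 \<longrightarrow> \<phi> 0 = (\<lambda>t. if t = 0 then x else 0)) \<and>
    (\<forall>s < r' i. \<phi> s \<in> hvec V (r i) (\<lambda>_. \<delta> i) (\<delta>' i + c)) \<and>
    (\<forall>z \<in> lc (r' (Suc i)) (A' i) ` free_module V (r' (Suc i)).
       lc (r' i) \<phi> z \<in> lc (r (Suc i)) (A i) ` free_module V (r (Suc i)))" for i \<phi>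
  define Q where "Q i \<phi> \<phi>' \<longleftrightarrow>
    (\<forall>w. lc (r (Suc i)) (A i) (lc (r' (Suc i)) \<phi>' w) = lc (r' i) \<phi> (lc (r' (Suc i)) (A' i) w))" for i \<phi> \<phi>'
  have "\<exists>\<phi>. \<forall>i. P i (\<phi> i) \<and> Q i (\<phi> i) (\<phi> (Suc i))"
  proof (rule dependent_nat_choice)
    let ?\<phi> = "\<lambda>(s::nat) (t::nat). if t = 0 then x else 0"
    have row: "?\<phi> s \<in> hvec V (r 0) (\<lambda>_. \<delta> 0) (\<delta>' 0 + c)" for s
      using x by (auto simp: hvec_def free_module_def pure_resD(1)[OF F] \<delta>0 homogeneous_pols)
    have "lc (r' 0) ?\<phi> z \<in> lc (r (Suc 0)) (A 0) ` free_module V (r (Suc 0))"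
      if "z \<in> lc (r' (Suc 0)) (A' 0) ` free_module V (r' (Suc 0))" for z
    proof -
      have z: "z \<in> free_module V (r' 0)" "z 0 \<in> K" using that pure_resD(3)[OF G] by auto
      have "lc (r' 0) ?\<phi> z \<in> free_module V (r 0)"
        by (rule lc_free) (use row hvec_free z in blast)+
      moreover have "lc (r' 0) ?\<phi> z 0 \<in> J"
        using colon[of "z 0"] z by (simp add: lc_def pure_resD(1)[OF G] free_pols[OF z(1)])
      ultimately show ?thesis using pure_resD(3)[OF F] by blast
    qed
    then have "P 0 ?\<phi>" unfolding P_def using row by blast
    then show "\<exists>\<phi>. P 0 \<phi>" by blast
  next
    fix \<phi> i assume P: "P i \<phi>"
    have A: "\<And>s. s < r (Suc i) \<Longrightarrow> A i s \<in> hvec V (r i) (\<lambda>_. \<delta> i) (\<delta> (Suc i))"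
      by (rule pure_resD(2)[OF F])
    have A': "\<And>s. s < r' (Suc i) \<Longrightarrow> A' i s \<in> hvec V (r' i) (\<lambda>_. \<delta>' i + c) (\<delta>' (Suc i) + c)"
      by (rule hvec_shift[OF pure_resD(2)[OF G]])
    have \<phi>: "\<And>s. s < r' i \<Longrightarrow> \<phi> s \<in> hvec V (r i) (\<lambda>_. \<delta> i) (\<delta>' i + c)"
      using P unfolding P_def by blast
    have im: "\<And>z. z \<in> lc (r' (Suc i)) (A' i) ` free_module V (r' (Suc i)) \<Longrightarrow>
       lc (r' i) \<phi> z \<in> lc (r (Suc i)) (A i) ` free_module V (r (Suc i))"
      using P unfolding P_def by blast
    obtain \<phi>' where \<phi>': "\<And>s. s < r' (Suc i) \<Longrightarrow> \<phi>' s \<in> hvec V (r (Suc i)) (\<lambda>_. \<delta> (Suc i)) (\<delta>' (Suc i) + c)"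
      and eq: "\<And>w. lc (r (Suc i)) (A i) (lc (r' (Suc i)) \<phi>' w) = lc (r' i) \<phi> (lc (r' (Suc i)) (A' i) w)"
      using lift_step[of "r (Suc i)" "A i" V "r i" "\<lambda>_. \<delta> i" "\<lambda>_. \<delta> (Suc i)" "r' (Suc i)" "A' i" "r' i"
          "\<lambda>_. \<delta>' i + c" "\<lambda>_. \<delta>' (Suc i) + c" \<phi>, OF A A' \<phi> im] by blast
    have "lc (r' (Suc i)) \<phi>' z \<in> lc (r (Suc (Suc i))) (A (Suc i)) ` free_module V (r (Suc (Suc i)))"
      if "z \<in> lc (r' (Suc (Suc i))) (A' (Suc i)) ` free_module V (r' (Suc (Suc i)))" for z
    proof -
      have z: "z \<in> free_module V (r' (Suc i))" "lc (r' (Suc i)) (A' i) z = (\<lambda>_. 0)"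
        using that pure_resD(4)[OF G, of i] by auto
      have "lc (r' (Suc i)) \<phi>' z \<in> free_module V (r (Suc i))"
        by (rule lc_free) (use \<phi>' hvec_free z in blast)+
      moreover have "lc (r (Suc i)) (A i) (lc (r' (Suc i)) \<phi>' z) = (\<lambda>_. 0)"
        by (simp add: eq z)
      ultimately show ?thesis using pure_resD(4)[OF F, of i] by blast
    qed
    then have "P (Suc i) \<phi>'" unfolding P_def using \<phi>' by blast
    then show "\<exists>\<phi>'. P (Suc i) \<phi>' \<and> Q i \<phi> \<phi>'" unfolding Q_def using eq by blast
  qed
  then obtain \<phi> where *: "\<And>i. P i (\<phi> i)" "\<And>i. Q i (\<phi> i) (\<phi> (Suc i))" by blast
  show ?thesis
  proof (intro exI[of _ \<phi>] conjI allI impI)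
    show "\<phi> 0 0 = (\<lambda>t. if t = 0 then x else 0)" using *(1)[of 0] unfolding P_def by blast
    show "\<phi> i s \<in> hvec V (r i) (\<lambda>_. \<delta> i) (\<delta>' i + c)" if "s < r' i" for i s
      using *(1)[of i] that unfolding P_def by blast
    show "lc (r (Suc i)) (A i) (lc (r' (Suc i)) (\<phi> (Suc i)) w) = lc (r' i) (\<phi> i) (lc (r' (Suc i)) (A' i) w)"
      for i w using *(2)[of i] unfolding Q_def by blast
  qed
qed

text \<open>Multiplication by \<open>x\<close> gives a short exact sequence from \<open>R/K\<close>,
  twisted by \<open>c\<close>, through \<open>R/J\<close> to \<open>R/J'\<close> with
  \<open>J' = J + xR\<close>. The cone of its lift resolves \<open>R/J'\<close>, and the assumption
  on \<open>\<delta>\<close> puts both summands of each cone term in the same degree.\<close>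

lemma mapping_cone:
  assumes F: "pure_res V J \<delta> r A" and G: "pure_res V K \<delta>' r' A'"
    and x: "x \<in> homogeneous_part V c" and \<delta>0: "\<delta> 0 = 0" "\<delta>' 0 = 0"
    and \<delta>: "\<And>i. \<delta> (Suc i) = \<delta>' i + c"
    and colon: "\<And>p. p \<in> pols V \<Longrightarrow> p * x \<in> J \<longleftrightarrow> p \<in> K"
    and sum: "\<And>p. p \<in> J' \<longleftrightarrow> (\<exists>j\<in>J. \<exists>q\<in>pols V. p = j + q * x)"
    and J: "J \<subseteq> pols V"
  shows "\<exists>D. pure_res V J' \<delta> (\<lambda>i. r i + (case i of 0 \<Rightarrow> 0 | Suc j \<Rightarrow> r' j)) D"
proof -
  obtain \<phi> where \<phi>0: "\<phi> 0 0 = (\<lambda>t. if t = 0 then x else 0)" and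
    \<phi>: "\<And>i s. s < r' i \<Longrightarrow> \<phi> i s \<in> hvec V (r i) (\<lambda>_. \<delta> i) (\<delta>' i + c)" and
    comm: "\<And>i w. lc (r (Suc i)) (A i) (lc (r' (Suc i)) (\<phi> (Suc i)) w) = lc (r' i) (\<phi> i) (lc (r' (Suc i)) (A' i) w)"
    using chain_map_exists[OF F G x \<delta>0 colon] by blast
  note r0 = pure_resD(1)[OF F] and r'0 = pure_resD(1)[OF G]
  define R where "R = (\<lambda>i. r i + (case i of 0 \<Rightarrow> 0 | Suc j \<Rightarrow> r' j))"
  have R: "R 0 = r 0" "R (Suc i) = r (Suc i) + r' i" for i by (simp_all add: R_def)
  define D where "D i = (case i of
      0 \<Rightarrow> join (r (Suc 0)) (A 0) (\<phi> 0)
    | Suc j \<Rightarrow> join (r (Suc i)) (\<lambda>s. join (r i) (A i s) (\<lambda>_. 0)) (\<lambda>s. join (r i) (\<phi> i s) (\<lambda>t. - A' j s t)))" for i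
  have D0: "lc (R (Suc 0)) (D 0) (join (r (Suc 0)) a b) = (\<lambda>t. lc (r (Suc 0)) (A 0) a t + lc (r' 0) (\<phi> 0) b t)" for a b
    by (simp add: R D_def lc_join)
  have DS: "lc (R (Suc (Suc i))) (D (Suc i)) (join (r (Suc (Suc i))) a b) =
      join (r (Suc i)) (\<lambda>t. lc (r (Suc (Suc i))) (A (Suc i)) a t + lc (r' (Suc i)) (\<phi> (Suc i)) b t)
        (\<lambda>t. - lc (r' (Suc i)) (A' i) b t)" for i a b
    by (simp add: R D_def lc_join lc_join_rows lc_rows_uminus) (simp add: join_def fun_eq_iff)
  have A: "A i s \<in> hvec V (r i) (\<lambda>_. \<delta> i) (\<delta> (Suc i))" if "s < r (Suc i)" for i s
    by (rule pure_resD(2)[OF F that])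
  have A': "A' i s \<in> hvec V (r' i) (\<lambda>_. \<delta> (Suc i)) (\<delta> (Suc (Suc i)))" if "s < r' (Suc i)" for i s
    unfolding \<delta> by (rule hvec_shift[OF pure_resD(2)[OF G that]])
  have A_free: "lc (r (Suc i)) (A i) w \<in> free_module V (r i)" if "w \<in> free_module V (r (Suc i))" for i w
    by (rule lc_free) (use A hvec_free that in blast)+
  have A'_free: "lc (r' (Suc i)) (A' i) w \<in> free_module V (r' i)" if "w \<in> free_module V (r' (Suc i))" for i w
    by (rule lc_free) (use A' hvec_free that in blast)+
  have \<phi>_free: "lc (r' i) (\<phi> i) w \<in> free_module V (r i)" if "w \<in> free_module V (r' i)" for i w
    by (rule lc_free) (use \<phi> hvec_free that in blast)+
  have AA: "lc (r (Suc i)) (A i) (lc (r (Suc (Suc i))) (A (Suc i)) w) = (\<lambda>_. 0)"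
    if "w \<in> free_module V (r (Suc (Suc i)))" for i w
    using pure_resD(4)[OF F, of i] that by blast
  have AA': "lc (r' (Suc i)) (A' i) (lc (r' (Suc (Suc i))) (A' (Suc i)) w) = (\<lambda>_. 0)"
    if "w \<in> free_module V (r' (Suc (Suc i)))" for i w
    using pure_resD(4)[OF G, of i] that by blast
  have lc_\<phi>0: "lc (r' 0) (\<phi> 0) b = (\<lambda>t. if t = 0 then b 0 * x else 0)" for b
    by (auto simp: lc_def r'0 \<phi>0)
  \<comment> \<open>The exactness argument: if the second component is the boundary of
    \<open>b'\<close>, then \<open>a + \<phi> b'\<close> is a cycle, hence the boundary of some
    \<open>a'\<close>, and the given vector is the image of \<open>(a', - b')\<close>.\<close>
  have lift: "join (r (Suc i)) a (lc (r' (Suc i)) (A' i) b')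
      \<in> lc (R (Suc (Suc i))) (D (Suc i)) ` free_module V (R (Suc (Suc i)))"
    if a: "a \<in> free_module V (r (Suc i))" and b': "b' \<in> free_module V (r' (Suc i))"
      and eq: "(\<lambda>t. lc (r (Suc i)) (A i) a t + lc (r' i) (\<phi> i) (lc (r' (Suc i)) (A' i) b') t) = (\<lambda>_. 0)"
    for i a b'
  proof -
    let ?a = "\<lambda>t. a t + lc (r' (Suc i)) (\<phi> (Suc i)) b' t"
    have "?a \<in> free_module V (r (Suc i))" by (intro free_add a \<phi>_free b')
    moreover have "lc (r (Suc i)) (A i) ?a = (\<lambda>_. 0)" using eq by (simp add: lc_add comm)
    ultimately obtain a' where a': "a' \<in> free_module V (r (Suc (Suc i)))"
      "?a = lc (r (Suc (Suc i))) (A (Suc i)) a'"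
      using pure_resD(4)[OF F, of i] by blast
    have "join (r (Suc i)) a (lc (r' (Suc i)) (A' i) b')
        = lc (R (Suc (Suc i))) (D (Suc i)) (join (r (Suc (Suc i))) a' (\<lambda>t. - b' t))"
      unfolding DS lc_uminus a'(2)[symmetric] by simp
    moreover have "join (r (Suc (Suc i))) a' (\<lambda>t. - b' t) \<in> free_module V (R (Suc (Suc i)))"
      unfolding R by (intro join_free a' free_uminus b')
    ultimately show ?thesis by blast
  qed
  have "pure_res V J' \<delta> R D"
    unfolding pure_res_def
  proof (intro conjI allI impI)
    show "R 0 = 1" by (simp add: R r0)
  next
    fix i s assume s: "s < R (Suc i)"
    show "D i s \<in> hvec V (R i) (\<lambda>_. \<delta> i) (\<delta> (Suc i))"
    proof (cases i)
      case 0
      then show ?thesis using s A[of s 0] \<phi>[of "s - r (Suc 0)" 0] by (auto simp: D_def join_def R \<delta>)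
    next
      case (Suc j)
      show ?thesis
      proof (cases "s < r (Suc i)")
        case True
        then have "D i s = join (r i) (A i s) (\<lambda>_. 0)" using Suc by (simp add: D_def join_def[of "r (Suc (Suc j))"])
        then show ?thesis using join_hvec[OF A[OF True] hvec_0[of V "r' j"]] Suc by (simp add: R)
      next
        case False
        then have s': "s - r (Suc i) < r' i" using s by (simp add: R)
        have "D i s = join (r i) (\<phi> i (s - r (Suc i))) (\<lambda>t. - A' j (s - r (Suc i)) t)"
          using Suc False by (simp add: D_def join_def[of "r (Suc (Suc j))"])
        moreover have "\<phi> i (s - r (Suc i)) \<in> hvec V (r i) (\<lambda>_. \<delta> i) (\<delta> (Suc i))"
          using \<phi>[OF s'] by (simp add: \<delta>)
        moreover have "(\<lambda>t. - A' j (s - r (Suc i)) t) \<in> hvec V (r' j) (\<lambda>_. \<delta> i) (\<delta> (Suc i))"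
          using hvec_uminus[OF A'] s' Suc by simp
        ultimately show ?thesis using join_hvec Suc by (simp add: R)
      qed
    qed
  next
    show "{w \<in> free_module V (R 0). w 0 \<in> J'} = lc (R (Suc 0)) (D 0) ` free_module V (R (Suc 0))"
    proof (intro equalityI subsetI)
      fix w assume "w \<in> {w \<in> free_module V (R 0). w 0 \<in> J'}"
      then have w: "w \<in> free_module V (r 0)" "w 0 \<in> J'" by (auto simp: R)
      then obtain j q where jq: "j \<in> J" "q \<in> pols V" "w 0 = j + q * x" using sum by blast
      let ?v = "\<lambda>t::nat. if t = 0 then j else 0" and ?b = "\<lambda>t::nat. if t = 0 then q else 0"
      have "?v \<in> free_module V (r 0)" using jq J by (auto simp: free_module_def r0)
      then obtain a where a: "a \<in> free_module V (r (Suc 0))" "?v = lc (r (Suc 0)) (A 0) a"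
        using pure_resD(3)[OF F] jq(1) by (smt (verit, best) imageE mem_Collect_eq)
      have b: "?b \<in> free_module V (r' 0)" using jq by (auto simp: free_module_def r'0)
      have "w t = 0" if "t > 0" for t using w that by (simp add: free_module_def r0)
      then have "w = lc (R (Suc 0)) (D 0) (join (r (Suc 0)) a ?b)"
        unfolding D0 lc_\<phi>0 a(2)[symmetric] using jq(3) by auto
      moreover have "join (r (Suc 0)) a ?b \<in> free_module V (R (Suc 0))"
        unfolding R by (intro join_free a b)
      ultimately show "w \<in> lc (R (Suc 0)) (D 0) ` free_module V (R (Suc 0))" by blast
    next
      fix w assume "w \<in> lc (R (Suc 0)) (D 0) ` free_module V (R (Suc 0))"
      then obtain z where z: "z \<in> free_module V (r (Suc 0) + r' 0)" "w = lc (R (Suc 0)) (D 0) z"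
        by (auto simp: R)
      obtain a b where ab: "a \<in> free_module V (r (Suc 0))" "b \<in> free_module V (r' 0)" "z = join (r (Suc 0)) a b"
        using join_cases[OF z(1)] by blast
      have w: "w = (\<lambda>t. lc (r (Suc 0)) (A 0) a t + lc (r' 0) (\<phi> 0) b t)"
        unfolding z(2) ab(3) D0 ..
      have "w \<in> free_module V (r 0)" unfolding w by (intro free_add A_free \<phi>_free ab)
      moreover have "lc (r (Suc 0)) (A 0) a 0 \<in> J" using pure_resD(3)[OF F] ab(1) by blast
      then have "w 0 \<in> J'" unfolding sum w lc_\<phi>0 using free_pols[OF ab(2)] by auto
      ultimately show "w \<in> {w \<in> free_module V (R 0). w 0 \<in> J'}" by (simp add: R)
    qed
  next
    fix i
    show "{w \<in> free_module V (R (Suc i)). lc (R (Suc i)) (D i) w = (\<lambda>_. 0)} =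
       lc (R (Suc (Suc i))) (D (Suc i)) ` free_module V (R (Suc (Suc i)))"
    proof (intro equalityI subsetI)
      fix w assume "w \<in> {w \<in> free_module V (R (Suc i)). lc (R (Suc i)) (D i) w = (\<lambda>_. 0)}"
      then have w: "w \<in> free_module V (r (Suc i) + r' i)" "lc (R (Suc i)) (D i) w = (\<lambda>_. 0)" by (auto simp: R)
      obtain a b where ab: "a \<in> free_module V (r (Suc i))" "b \<in> free_module V (r' i)" "w = join (r (Suc i)) a b"
        using join_cases[OF w(1)] by blast
      \<comment> \<open>The second component of a cycle is a boundary. For \<open>i = 0\<close> the
        first equation gives \<open>b 0 * x \<in> J\<close>, and the colon condition yields
        \<open>b 0 \<in> K\<close>; in higher degrees the second block says that \<open>b\<close> is
        a cycle.\<close>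
      have "(\<lambda>t. lc (r (Suc i)) (A i) a t + lc (r' i) (\<phi> i) b t) = (\<lambda>_. 0) \<and>
          b \<in> lc (r' (Suc i)) (A' i) ` free_module V (r' (Suc i))"
      proof (cases i)
        case 0
        have eq: "(\<lambda>t. lc (r (Suc 0)) (A 0) a t + lc (r' 0) (\<phi> 0) b t) = (\<lambda>_. 0)"
          using w(2) unfolding ab(3) 0 D0 .
        have "b 0 * x = lc (r (Suc 0)) (A 0) (\<lambda>t. - a t) 0"
          using fun_cong[OF eq, of 0] unfolding lc_uminus lc_\<phi>0
          by (simp add: eq_neg_iff_add_eq_0 add.commute)
        also have "\<dots> \<in> J"
          using pure_resD(3)[OF F] free_uminus[OF ab(1)] 0 by blast
        finally have "b 0 \<in> K" using colon free_pols[OF ab(2)] by blast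
        then show ?thesis using eq pure_resD(3)[OF G] ab(2) 0 by blast
      next
        case (Suc j)
        let ?u = "\<lambda>t. lc (r (Suc i)) (A i) a t + lc (r' i) (\<phi> i) b t"
        have "join (r i) ?u (\<lambda>t. - lc (r' i) (A' j) b t) = (\<lambda>_. 0)"
          using w(2) unfolding ab(3) Suc DS .
        moreover have "?u \<in> free_module V (r i)" by (intro free_add A_free \<phi>_free ab)
        ultimately have *: "?u = (\<lambda>_. 0)" "(\<lambda>t. - lc (r' i) (A' j) b t) = (\<lambda>_. 0)"
          using join_eq_0_iff by blast+
        have "lc (r' (Suc j)) (A' j) b = (\<lambda>_. 0)"
          using *(2) unfolding fun_eq_iff Suc by simp
        then have "b \<in> lc (r' (Suc (Suc j))) (A' (Suc j)) ` free_module V (r' (Suc (Suc j)))"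
          using pure_resD(4)[OF G, of j] ab(2) unfolding Suc by blast
        then show ?thesis using *(1) unfolding Suc by blast
      qed
      then show "w \<in> lc (R (Suc (Suc i))) (D (Suc i)) ` free_module V (R (Suc (Suc i)))"
        using lift[OF ab(1)] unfolding ab(3) by blast
    next
      fix w assume "w \<in> lc (R (Suc (Suc i))) (D (Suc i)) ` free_module V (R (Suc (Suc i)))"
      then obtain z where z: "z \<in> free_module V (r (Suc (Suc i)) + r' (Suc i))"
        "w = lc (R (Suc (Suc i))) (D (Suc i)) z" by (auto simp: R)
      obtain a b where ab: "a \<in> free_module V (r (Suc (Suc i)))" "b \<in> free_module V (r' (Suc i))"
        "z = join (r (Suc (Suc i))) a b"
        using join_cases[OF z(1)] by blast
      let ?u = "\<lambda>t. lc (r (Suc (Suc i))) (A (Suc i)) a t + lc (r' (Suc i)) (\<phi> (Suc i)) b t"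
      let ?v = "\<lambda>t. - lc (r' (Suc i)) (A' i) b t"
      have w: "w = join (r (Suc i)) ?u ?v" unfolding z(2) ab(3) DS ..
      have free: "w \<in> free_module V (R (Suc i))"
        unfolding w R by (intro join_free free_add free_uminus A_free A'_free \<phi>_free ab)
      \<comment> \<open>By \<open>comm\<close> the two contributions of \<open>b\<close> agree up to
        sign and cancel.\<close>
      have u: "(\<lambda>t. lc (r (Suc i)) (A i) ?u t + lc (r' i) (\<phi> i) ?v t) = (\<lambda>_. 0)"
        by (simp add: lc_add lc_uminus AA[OF ab(1)] comm)
      have "lc (R (Suc i)) (D i) w = (\<lambda>_. 0)"
      proof (cases i)
        case 0
        show ?thesis using u unfolding w 0 D0 .
      next
        case (Suc j)
        have "lc (r' (Suc j)) (A' j) ?v = (\<lambda>_. 0)"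
          using AA'[of b j] ab(2) unfolding Suc lc_uminus by simp
        then show ?thesis using u unfolding w Suc DS by (simp add: join_def)
      qed
      with free show "w \<in> {w \<in> free_module V (R (Suc i)). lc (R (Suc i)) (D i) w = (\<lambda>_. 0)}" by blast
    qed
  qed
  then show ?thesis unfolding R_def by blast
qed

section \<open>The resolution of the quotient ring of a threshold graph\<close>

lemma monomial_factor:
  assumes p: "p \<in> pols V" and div: "\<And>m. m \<in> Poly_Mapping.keys p \<Longrightarrow> \<exists>b. m = a + b"
  shows "\<exists>q\<in>pols V. p = q * Poly_Mapping.single a (1::'k::field)"
proof -
  obtain b where b: "\<And>m. m \<in> Poly_Mapping.keys p \<Longrightarrow> m = a + b m" using div by metis
  let ?q = "\<Sum>m\<in>Poly_Mapping.keys p. Poly_Mapping.single (b m) (Poly_Mapping.lookup p m)"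
  have "Poly_Mapping.keys (b m) \<subseteq> V" if "m \<in> Poly_Mapping.keys p" for m
    using p that b[OF that] keys_add_nat[of a "b m"] unfolding pols_iff by (metis Un_subset_iff)
  then have "?q \<in> pols V" by (intro pols_sum pols_single)
  moreover have "?q * Poly_Mapping.single a 1 = p"
  proof -
    have "?q * Poly_Mapping.single a 1
        = (\<Sum>m\<in>Poly_Mapping.keys p. Poly_Mapping.single m (Poly_Mapping.lookup p m))"
      unfolding sum_distrib_right
      by (rule sum.cong) (use b in \<open>auto simp: mult_single add.commute[of _ a]\<close>)
    then show ?thesis by (simp add: poly_mapping_expand[symmetric])
  qed
  ultimately show ?thesis by metis
qed

text \<open>For a monomial \<open>x\<close> both ideal-theoretic hypotheses of the cone become
  combinatorial: the colon ideal shifts the predicate by \<open>a\<close>, and adding the generator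
  adjoins all multiples of \<open>a\<close>.\<close>

lemma mapping_cone_monomial:
  fixes V :: "'v set" and A A' :: "nat \<Rightarrow> nat \<Rightarrow> nat \<Rightarrow> ('v, 'k::field) mpoly"
  assumes F: "pure_res V (mon_ideal V U) \<delta> r A"
    and G: "pure_res V (mon_ideal V (\<lambda>m. U (a + m))) \<delta>' r' A'"
    and a: "Poly_Mapping.keys a \<subseteq> V" and U: "upset U"
    and \<delta>: "\<delta> 0 = 0" "\<delta>' 0 = 0" "\<And>i. \<delta> (Suc i) = \<delta>' i + mono_deg a"
  shows "\<exists>D :: nat \<Rightarrow> nat \<Rightarrow> nat \<Rightarrow> ('v, 'k) mpoly. pure_res V (mon_ideal V (\<lambda>m. U m \<or> (\<exists>b. m = a + b))) \<delta>
      (\<lambda>i. r i + (case i of 0 \<Rightarrow> 0 | Suc j \<Rightarrow> r' j)) D"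
proof (rule mapping_cone[OF F G _ \<delta>])
  let ?x = "Poly_Mapping.single a (1::'k)"
  show "?x \<in> homogeneous_part V (mono_deg a)" by (rule homogeneous_single[OF a])
  have x: "?x \<in> pols V" by (rule pols_single[OF a])
  show "p * ?x \<in> mon_ideal V U \<longleftrightarrow> p \<in> mon_ideal V (\<lambda>m. U (a + m))" if "p \<in> pols V" for p
    using pols_mult[OF that x] that keys_single_mult[of "1::'k" a p]
    by (simp add: mon_ideal_def mult.commute[of p])
  show "mon_ideal V U \<subseteq> pols V" by (auto simp: mon_ideal_def)
  show "p \<in> mon_ideal V (\<lambda>m. U m \<or> (\<exists>b. m = a + b)) \<longleftrightarrow> (\<exists>j\<in>mon_ideal V U. \<exists>q\<in>pols V. p = j + q * ?x)" for p
  proof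
    assume p: "p \<in> mon_ideal V (\<lambda>m. U m \<or> (\<exists>b. m = a + b))"
    \<comment> \<open>The terms of \<open>p\<close> outside \<open>U\<close> are all divisible by
      the new monomial, so it can be factored out of \<open>?l\<close>.\<close>
    let ?j = "restrict_keys U p" and ?l = "restrict_keys (\<lambda>m. \<not> U m) p"
    have "?j \<in> mon_ideal V U" using p by (auto simp: mon_ideal_def pols_iff keys_restrict_keys)
    moreover have "\<exists>q\<in>pols V. ?l = q * ?x"
      by (rule monomial_factor) (use p in \<open>auto simp: mon_ideal_def pols_iff keys_restrict_keys\<close>)
    moreover have "p = ?j + ?l"
      by (rule poly_mapping_eqI) (simp add: lookup_add lookup_restrict_keys)
    ultimately show "\<exists>j\<in>mon_ideal V U. \<exists>q\<in>pols V. p = j + q * ?x" by metis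
  next
    assume "\<exists>j\<in>mon_ideal V U. \<exists>q\<in>pols V. p = j + q * ?x"
    then obtain j q where jq: "j \<in> mon_ideal V U" "q \<in> pols V" "p = j + q * ?x" by blast
    have "m \<in> Poly_Mapping.keys j \<or> (\<exists>b. m = a + b)" if "m \<in> Poly_Mapping.keys p" for m
      using that keys_add[of j "q * ?x"] keys_single_mult[of "1::'k" a q]
      unfolding jq(3) by (auto simp: mult.commute[of q])
    then show "p \<in> mon_ideal V (\<lambda>m. U m \<or> (\<exists>b. m = a + b))"
      using jq x by (auto simp: mon_ideal_def pols_add pols_mult)
  qed
qed

lemma pure_res_zero:
  "pure_res V (mon_ideal V (\<lambda>_. False)) \<delta> (\<lambda>i. if i = 0 then 1 else 0) (\<lambda>_ _ _. 0)"
proof -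
  have free0: "free_module V 0 = {\<lambda>_. 0}" by (auto simp: free_module_def)
  have "mon_ideal V (\<lambda>_. False) = {0}" by (auto simp: mon_ideal_def keys_eq_empty)
  moreover have "w = (\<lambda>_. 0)" if "w \<in> free_module V (Suc 0)" "w 0 = 0" for w
    using that by (auto simp: free_module_def fun_eq_iff) (metis gr0_conv_Suc neq0_conv not_less_eq_eq le0)
  ultimately show ?thesis
    unfolding pure_res_def by (auto simp: free0 intro: free_0)
qed

text \<open>The Koszul complex, built by adjoining one variable at a time; the ranks satisfy
  Pascal's rule.\<close>

lemma koszul_resolution:
  assumes "finite Y" "Y \<subseteq> V"
  shows "\<exists>A :: nat \<Rightarrow> nat \<Rightarrow> nat \<Rightarrow> ('v, 'k::field) mpoly.
    pure_res V (mon_ideal V (\<lambda>m. \<exists>y\<in>Y. 0 < Poly_Mapping.lookup m y)) id (\<lambda>i. card Y choose i) A"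
  using assms
proof (induction Y rule: finite_induct)
  case empty
  have "(\<lambda>i. card ({}::'v set) choose i) = (\<lambda>i. if i = 0 then 1 else 0)" by auto
  then show ?case using pure_res_zero by auto
next
  case (insert y Y)
  let ?U = "\<lambda>m. \<exists>y\<in>Y. 0 < Poly_Mapping.lookup m y" and ?a = "Poly_Mapping.single y (1::nat)"
  obtain A :: "nat \<Rightarrow> nat \<Rightarrow> nat \<Rightarrow> ('v, 'k) mpoly"
    where A: "pure_res V (mon_ideal V ?U) id (\<lambda>i. card Y choose i) A"
    using insert.IH insert.prems by blast
  \<comment> \<open>As \<open>y\<close> is not in \<open>Y\<close>, its variable is a nonzerodivisor
    modulo those of \<open>Y\<close>. The colon ideal is thus the ideal itself, and the cone joins
    two copies of one complex.\<close>
  have colon: "(\<lambda>m. ?U (?a + m)) = ?U"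
    using insert.hyps(2) by (auto simp: lookup_add lookup_single when_def fun_eq_iff)
  have "\<exists>D :: nat \<Rightarrow> nat \<Rightarrow> nat \<Rightarrow> ('v, 'k) mpoly. pure_res V (mon_ideal V (\<lambda>m. ?U m \<or> (\<exists>b. m = ?a + b))) id
      (\<lambda>i. (card Y choose i) + (case i of 0 \<Rightarrow> 0 | Suc j \<Rightarrow> card Y choose j)) D"
    by (rule mapping_cone_monomial[OF A A[folded colon]])
      (use insert.prems in \<open>auto simp: upset_def lookup_add\<close>)
  moreover have "(\<lambda>i. (card Y choose i) + (case i of 0 \<Rightarrow> 0 | Suc j \<Rightarrow> card Y choose j))
      = (\<lambda>i. card (insert y Y) choose i)"
    using insert.hyps by (auto simp: fun_eq_iff split: nat.split)
  moreover have "(\<lambda>m. ?U m \<or> (\<exists>b. m = ?a + b)) = (\<lambda>m. \<exists>y\<in>insert y Y. 0 < Poly_Mapping.lookup m y)"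
    unfolding single_le_iff by (auto simp: fun_eq_iff)
  ultimately show ?case by (simp only:)
qed

definition edge_upset :: "('v \<times> 'v) set \<Rightarrow> ('v \<Rightarrow>\<^sub>0 nat) \<Rightarrow> bool" where
  "edge_upset E m \<longleftrightarrow> (\<exists>(u, v)\<in>E. 0 < Poly_Mapping.lookup m u \<and> 0 < Poly_Mapping.lookup m v)"

lemma upset_edge_upset: "upset (edge_upset E)"
  by (auto simp: upset_def edge_upset_def lookup_add)

lemma edge_multiple_iff:
  fixes m :: "'v \<Rightarrow>\<^sub>0 nat"
  assumes "u \<noteq> v"
  shows "(\<exists>b. m = Poly_Mapping.single u 1 + Poly_Mapping.single v 1 + b) \<longleftrightarrow>
    0 < Poly_Mapping.lookup m u \<and> 0 < Poly_Mapping.lookup m v" (is "(\<exists>b. m = ?a + b) \<longleftrightarrow> _")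
proof
  assume *: "0 < Poly_Mapping.lookup m u \<and> 0 < Poly_Mapping.lookup m v"
  have "m = ?a + (m - ?a)"
    by (rule poly_mapping_eqI) (use * assms in \<open>auto simp: lookup_add lookup_minus lookup_single when_def\<close>)
  then show "\<exists>b. m = ?a + b" by blast
qed (auto simp: lookup_add)

text \<open>The internal degrees 0, 2, 3, 4, ... of a linear resolution of a quotient by
  quadrics.\<close>

definition linear_shift :: "nat \<Rightarrow> nat" where
  "linear_shift i = (if i = 0 then 0 else i + 1)"

text \<open>The colon ideal has a Koszul resolution with degree \<open>i\<close> in position
  \<open>i\<close>. The quadratic generator shifts it by two and the cone moves it up one position,
  which fits \<open>linear_shift (Suc i) = i + 2\<close>.\<close>

lemma linear_quotient_step:
  fixes V :: "'v set" and A :: "nat \<Rightarrow> nat \<Rightarrow> nat \<Rightarrow> ('v, 'k::field) mpoly"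
  assumes F: "pure_res V (mon_ideal V (edge_upset E)) linear_shift r A"
    and uv: "u \<in> V" "v \<in> V" "u \<noteq> v" and Y: "finite Y" "Y \<subseteq> V"
    and colon: "\<And>m. edge_upset E (Poly_Mapping.single u 1 + Poly_Mapping.single v 1 + m) \<longleftrightarrow>
      (\<exists>y\<in>Y. 0 < Poly_Mapping.lookup m y)"
  shows "\<exists>D :: nat \<Rightarrow> nat \<Rightarrow> nat \<Rightarrow> ('v, 'k) mpoly. pure_res V (mon_ideal V (edge_upset (insert (u, v) E))) linear_shift
    (\<lambda>i. r i + (if i = 0 then 0 else card Y choose (i - 1))) D"
proof -
  let ?a = "Poly_Mapping.single u (1::nat) + Poly_Mapping.single v 1"
  obtain A' :: "nat \<Rightarrow> nat \<Rightarrow> nat \<Rightarrow> ('v, 'k) mpoly"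
    where "pure_res V (mon_ideal V (\<lambda>m. \<exists>y\<in>Y. 0 < Poly_Mapping.lookup m y)) id (\<lambda>i. card Y choose i) A'"
    using koszul_resolution[OF Y] by blast
  then have G: "pure_res V (mon_ideal V (\<lambda>m. edge_upset E (?a + m))) id (\<lambda>i. card Y choose i) A'"
    unfolding colon .
  have "\<exists>D :: nat \<Rightarrow> nat \<Rightarrow> nat \<Rightarrow> ('v, 'k) mpoly. pure_res V (mon_ideal V (\<lambda>m. edge_upset E m \<or> (\<exists>b. m = ?a + b))) linear_shift
      (\<lambda>i. r i + (case i of 0 \<Rightarrow> 0 | Suc j \<Rightarrow> card Y choose j)) D"
    by (rule mapping_cone_monomial[OF F G])
      (use uv in \<open>auto simp: keys_add_nat upset_edge_upset linear_shift_def mono_deg_add\<close>)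
  moreover have "(\<lambda>m. edge_upset E m \<or> (\<exists>b. m = ?a + b)) = edge_upset (insert (u, v) E)"
    unfolding edge_multiple_iff[OF uv(3)] by (auto simp: edge_upset_def fun_eq_iff)
  moreover have "(\<lambda>i. r i + (case i of 0 \<Rightarrow> 0 | Suc j \<Rightarrow> card Y choose j))
      = (\<lambda>i. r i + (if i = 0 then 0 else card Y choose (i - 1)))"
    by (auto simp: fun_eq_iff split: nat.split)
  ultimately show ?thesis by simp
qed

text \<open>For \<open>u = 0\<close> no pair with larger entry \<open>v\<close> qualifies, so
  \<open>nonedges_before \<sigma> v 0\<close> consists of the pairs with larger entry below
  \<open>v\<close>.\<close>

definition nonedges_before :: "nat set \<Rightarrow> nat \<Rightarrow> nat \<Rightarrow> (nat \<times> nat) set" where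
  "nonedges_before \<sigma> v u = {(a, b). a < b \<and> b \<in> \<sigma> \<and> (b < v \<or> b = v \<and> a < u)}"

definition nonedge_rank :: "nat set \<Rightarrow> nat \<Rightarrow> nat \<Rightarrow> nat" where
  "nonedge_rank \<sigma> a b = card ({..<a} \<union> (\<sigma> \<inter> {a<..<b}))"

lemma finite_nonedges_before: "finite (nonedges_before \<sigma> v u)"
  by (rule finite_subset[of _ "{..v} \<times> {..v}"]) (auto simp: nonedges_before_def)

text \<open>The 1 is the rank of \<open>F_0 = R\<close>; every non-edge contributes a Koszul complex
  on the variables of its colon ideal, moved up by one homological degree.\<close>

definition ranks :: "nat set \<Rightarrow> (nat \<times> nat) set \<Rightarrow> nat \<Rightarrow> nat" where
  "ranks \<sigma> E i = (if i = 0 then 1 else \<Sum>(a, b)\<in>E. nonedge_rank \<sigma> a b choose (i - 1))"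

text \<open>A variable with \<open>y < u\<close> belongs to the colon ideal because of the earlier
  non-edge \<open>(y, v)\<close>, and one with \<open>y \<in> \<sigma>\<close> between
  \<open>u\<close> and \<open>v\<close> because of \<open>(u, y)\<close>. Conversely, every earlier
  non-edge has an endpoint of one of these kinds.\<close>

lemma nonedges_before_colon:
  assumes "v \<in> \<sigma>" "u < v"
  shows "edge_upset (nonedges_before \<sigma> v u) (Poly_Mapping.single u 1 + Poly_Mapping.single v 1 + m) \<longleftrightarrow>
    (\<exists>y \<in> {..<u} \<union> (\<sigma> \<inter> {u<..<v}). 0 < Poly_Mapping.lookup m y)" (is "?L \<longleftrightarrow> ?R")
proof -
  let ?m = "Poly_Mapping.single u 1 + Poly_Mapping.single v 1 + m"
  have pos: "0 < Poly_Mapping.lookup ?m w \<longleftrightarrow> w = u \<or> w = v \<or> 0 < Poly_Mapping.lookup m w" for w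
    by (auto simp: lookup_add lookup_single when_def)
  show ?thesis
  proof
    assume ?L
    then obtain a b where ab: "a < b" "b \<in> \<sigma>" "b < v \<or> b = v \<and> a < u"
      "0 < Poly_Mapping.lookup ?m a" "0 < Poly_Mapping.lookup ?m b"
      by (auto simp: edge_upset_def nonedges_before_def)
    \<comment> \<open>If \<open>b\<close> equals \<open>u\<close> or \<open>v\<close>, then
      \<open>a < u\<close>, which is the first alternative.\<close>
    consider "a < u" "0 < Poly_Mapping.lookup m a" | "b < u" | "u < b" "b < v"
      using ab unfolding pos by linarith
    then show ?R
    proof cases
      case 2
      then have "0 < Poly_Mapping.lookup m b" using ab assms unfolding pos by auto
      then show ?thesis using 2 by blast
    next
      case 3
      then have "0 < Poly_Mapping.lookup m b" using ab unfolding pos by auto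
      then show ?thesis using 3 ab by auto
    qed auto
  next
    assume ?R
    then obtain y where "y \<in> {..<u} \<union> (\<sigma> \<inter> {u<..<v})" and y: "0 < Poly_Mapping.lookup m y" by blast
    then have "(y, v) \<in> nonedges_before \<sigma> v u \<or> (u, y) \<in> nonedges_before \<sigma> v u"
      using assms by (auto simp: nonedges_before_def)
    then show ?L unfolding edge_upset_def pos using y by blast
  qed
qed

text \<open>The inner induction: for fixed \<open>v \<in> \<sigma>\<close> the non-edges with larger
  endpoint \<open>v\<close> are adjoined one at a time.\<close>

lemma nonedges_before_resolution:
  assumes "n \<ge> v" "v \<in> \<sigma>" "u \<le> v"
    and "\<exists>A :: nat \<Rightarrow> nat \<Rightarrow> nat \<Rightarrow> (nat, 'k::field) mpoly.
      pure_res {0..n} (mon_ideal {0..n} (edge_upset (nonedges_before \<sigma> v 0))) linear_shift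
        (ranks \<sigma> (nonedges_before \<sigma> v 0)) A"
  shows "\<exists>A :: nat \<Rightarrow> nat \<Rightarrow> nat \<Rightarrow> (nat, 'k) mpoly.
      pure_res {0..n} (mon_ideal {0..n} (edge_upset (nonedges_before \<sigma> v u))) linear_shift
        (ranks \<sigma> (nonedges_before \<sigma> v u)) A"
  using assms(3)
proof (induction u)
  case 0
  show ?case by (rule assms(4))
next
  case (Suc u)
  let ?Y = "{..<u} \<union> (\<sigma> \<inter> {u<..<v})" and ?E = "nonedges_before \<sigma> v u"
  obtain A :: "nat \<Rightarrow> nat \<Rightarrow> nat \<Rightarrow> (nat, 'k) mpoly"
    where A: "pure_res {0..n} (mon_ideal {0..n} (edge_upset ?E)) linear_shift (ranks \<sigma> ?E) A"
    using Suc by auto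
  have "\<exists>D :: nat \<Rightarrow> nat \<Rightarrow> nat \<Rightarrow> (nat, 'k) mpoly.
      pure_res {0..n} (mon_ideal {0..n} (edge_upset (insert (u, v) ?E))) linear_shift
      (\<lambda>i. ranks \<sigma> ?E i + (if i = 0 then 0 else card ?Y choose (i - 1))) D"
    by (rule linear_quotient_step[OF A _ _ _ _ _ nonedges_before_colon])
      (use Suc.prems assms(1,2) in auto)
  moreover have E: "insert (u, v) ?E = nonedges_before \<sigma> v (Suc u)"
    using Suc.prems assms(2) by (auto simp: nonedges_before_def)
  moreover have "(u, v) \<notin> ?E" by (simp add: nonedges_before_def)
  then have "(\<lambda>i. ranks \<sigma> ?E i + (if i = 0 then 0 else card ?Y choose (i - 1)))
      = ranks \<sigma> (nonedges_before \<sigma> v (Suc u))"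
    unfolding E[symmetric] by (auto simp: ranks_def fun_eq_iff finite_nonedges_before nonedge_rank_def)
  ultimately show ?case by simp
qed

lemma threshold_resolution:
  assumes "v \<le> n + 1"
  shows "\<exists>A :: nat \<Rightarrow> nat \<Rightarrow> nat \<Rightarrow> (nat, 'k::field) mpoly.
      pure_res {0..n} (mon_ideal {0..n} (edge_upset (nonedges_before \<sigma> v 0))) linear_shift
        (ranks \<sigma> (nonedges_before \<sigma> v 0)) A"
  using assms
proof (induction v)
  case 0
  have E: "nonedges_before \<sigma> 0 0 = {}" by (auto simp: nonedges_before_def)
  have r: "ranks \<sigma> {} = (\<lambda>i. if i = 0 then 1 else 0)" by (auto simp: ranks_def fun_eq_iff)
  have e: "edge_upset {} = (\<lambda>_. False)" by (auto simp: edge_upset_def fun_eq_iff)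
  show ?case unfolding E r e by (rule exI) (rule pure_res_zero)
next
  case (Suc v)
  show ?case
  proof (cases "v \<in> \<sigma>")
    case True
    \<comment> \<open>The smaller endpoint is always below \<open>v\<close>, so the inner induction
      finishes at \<open>u = v\<close>.\<close>
    have "nonedges_before \<sigma> (Suc v) 0 = nonedges_before \<sigma> v v" by (auto simp: nonedges_before_def)
    then show ?thesis
      using nonedges_before_resolution[of v n \<sigma> v] Suc True by auto
  next
    case False
    then have "nonedges_before \<sigma> (Suc v) 0 = nonedges_before \<sigma> v 0"
      by (auto simp: nonedges_before_def less_Suc_eq)
    then show ?thesis using Suc by auto
  qed
qed

section \<open>Graded Betti numbers of the quotient ring\<close>

lemma finsum_poly_ring:
  assumes "finite S" "\<And>s. s \<in> S \<Longrightarrow> f s \<in> pols V"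
  shows "(\<Oplus>\<^bsub>poly_ring V\<^esub>s\<in>S. f s) = (\<Sum>s\<in>S. f s)"
proof -
  interpret R: cring "poly_ring V" by (rule poly_ring_cring)
  show ?thesis using assms by (induction S rule: finite_induct) (auto simp: Pi_iff)
qed

lemma minus_poly_ring:
  fixes f g :: "('v, 'k::field) mpoly"
  assumes "f \<in> pols V" "g \<in> pols V"
  shows "f \<ominus>\<^bsub>poly_ring V\<^esub> g = f - g"
proof -
  interpret R: cring "poly_ring V" by (rule poly_ring_cring)
  have "\<ominus>\<^bsub>poly_ring V\<^esub> g = - g"
    by (rule R.minus_equality) (simp_all add: assms pols_uminus)
  then show ?thesis by (simp add: a_minus_def)
qed

context
  fixes G :: "'v graph" and J :: "('v, 'k::field) mpoly set" and U
  assumes U: "upset U" and J: "J = mon_ideal (fst G) U" "J = nonedge_ideal G"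
begin

private abbreviation "V \<equiv> fst G"
private abbreviation "coset f \<equiv> J +>\<^bsub>poly_ring V\<^esub> f"
private abbreviation "M \<equiv> graph_quotient G :: (('v, 'k) mpoly, ('v, 'k) mpoly set) graded_module"

lemma ideal_nonedge_ideal: "ideal J (poly_ring V)"
  unfolding J(1) by (rule mon_ideal_ideal[OF U])

lemma coset_hom: "ring_hom_cring (poly_ring V) (poly_ring V Quot J) coset"
  by (rule ideal.rcos_ring_hom_cring[OF ideal_nonedge_ideal poly_ring_cring])

lemma coset_eq_iff:
  assumes "f \<in> pols V" "g \<in> pols V"
  shows "coset f = coset g \<longleftrightarrow> f - g \<in> J"
proof -
  interpret R: cring "poly_ring V" by (rule poly_ring_cring)
  show ?thesis
    using R.quotient_eq_iff_same_a_r_cos[OF ideal_nonedge_ideal assms] minus_poly_ring[OF assms] by simp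
qed

lemma quotient_zero: "\<zero>\<^bsub>M\<^esub> = coset 0"
proof -
  interpret H: ring_hom_cring "poly_ring V" "poly_ring V Quot J" coset by (rule coset_hom)
  show ?thesis using H.hom_zero by (simp add: graph_quotient_def J(2)[symmetric] Let_def)
qed

lemma quotient_carrier: "carrier M = coset ` pols V"
  by (auto simp: graph_quotient_def J(2)[symmetric] Let_def FactRing_def A_RCOSETS_def')

lemma augmentation_eq:
  assumes f: "\<And>s. s < r \<Longrightarrow> f s \<in> pols V" and g: "\<And>s. s < r \<Longrightarrow> g s = coset (f s)"
    and w: "w \<in> free_module V r"
  shows "augmentation M r g w = coset (lc r (column f) w 0)"
proof -
  interpret H: ring_hom_cring "poly_ring V" "poly_ring V Quot J" coset by (rule coset_hom)
  \<comment> \<open>The module and the quotient ring are different records, but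
    \<open>finsum\<close> reads only their common additive structure.\<close>
  have fin: "finsum M h S = finsum (poly_ring V Quot J) h S" for h and S :: "nat set"
    by (simp add: finsum_def finprod_def graph_quotient_def J(2)[symmetric] Let_def)
  have wf: "w s * f s \<in> pols V" if "s < r" for s
    using f[OF that] free_pols[OF w] by (rule pols_mult[rotated])
  have "w s \<odot>\<^bsub>M\<^esub> g s = coset (w s * f s)" if "s < r" for s
    using H.hom_mult[OF free_pols[OF w] f[OF that]] g[OF that]
    by (simp add: graph_quotient_def J(2)[symmetric] Let_def)
  then have "augmentation M r g w = (\<Oplus>\<^bsub>poly_ring V Quot J\<^esub>s\<in>{..<r}. coset (w s * f s))"
    unfolding augmentation_def fin by (intro H.S.finsum_cong') (auto intro: wf)
  also have "\<dots> = coset (\<Oplus>\<^bsub>poly_ring V\<^esub>s\<in>{..<r}. w s * f s)"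
    using H.hom_finsum[of "\<lambda>s. w s * f s" "{..<r}"] wf by (simp add: comp_def Pi_iff)
  also have "(\<Oplus>\<^bsub>poly_ring V\<^esub>s\<in>{..<r}. w s * f s) = lc r (column f) w 0"
    using wf by (subst finsum_poly_ring) (auto simp: lc_def column_def)
  finally show ?thesis .
qed

text \<open>Translation to \<open>gres\<close>: the generators are represented by polynomials, the
  matrix index drops by one, and entries beyond the target rank are set to 0 so that rows lie in
  free modules. Membership in the irrelevant ideal remains as a conjunct because \<open>gres\<close>
  keeps only its consequence on constant terms.\<close>

lemma minimal_graded_free_resolution_iff:
  assumes f: "\<And>s. s < r 0 \<Longrightarrow> f s \<in> homogeneous_part V (d 0 s)"
    and g: "\<And>s. s < r 0 \<Longrightarrow> g s = coset (f s)"
  shows "minimal_graded_free_resolution V M r d g A \<longleftrightarrow>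
    gres V J r d f (\<lambda>i s t. if t < r i then A (Suc i) s t else 0) \<and>
    (\<forall>i. \<forall>s < r (Suc i). \<forall>t < r i. A (Suc i) s t \<in> irrelevant_ideal V)"
proof -
  let ?A = "\<lambda>i s t. if t < r i then A (Suc i) s t else 0"
  have fp: "\<And>s. s < r 0 \<Longrightarrow> f s \<in> pols V" using f homogeneous_pols by blast
  have lcp: "lc (r 0) (column f) w 0 \<in> pols V" if "w \<in> free_module V (r 0)" for w
    using fp free_pols[OF that] by (auto simp: lc_def column_def intro!: pols_sum pols_mult)
  have aug: "augmentation M (r 0) g w = coset (lc (r 0) (column f) w 0)" if "w \<in> free_module V (r 0)" for w
    by (rule augmentation_eq[OF fp g that])
  have gens: "\<forall>s<r 0. g s \<in> component M (d 0 s)"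
    using f g by (auto simp: graph_quotient_def J(2)[symmetric] Let_def)
  have rows: "(\<forall>i. \<forall>s < r (Suc i). \<forall>t < r i. A (Suc i) s t \<noteq> 0 \<longrightarrow>
          d i t \<le> d (Suc i) s \<and> A (Suc i) s t \<in> homogeneous_part V (d (Suc i) s - d i t)) \<longleftrightarrow>
      (\<forall>i. \<forall>s < r (Suc i). ?A i s \<in> hvec V (r i) (d i) (d (Suc i) s))"
  proof -
    have *: "(\<forall>t < q. a t \<noteq> 0 \<longrightarrow> dq t \<le> e \<and> a t \<in> homogeneous_part V (e - dq t)) \<longleftrightarrow>
      (\<lambda>t. if t < q then a t else 0) \<in> hvec V q dq e" for q :: nat and a dq e
      by (auto simp: hvec_def free_module_def split: if_splits) (metis homogeneous_pols pols_0)
    show ?thesis by (intro iff_allI imp_cong refl *)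
  qed
  have surj: "augmentation M (r 0) g ` free_module V (r 0) = carrier M \<longleftrightarrow>
      (\<forall>p \<in> pols V. \<exists>w \<in> free_module V (r 0). p - lc (r 0) (column f) w 0 \<in> J)"
  proof -
    have eq: "augmentation M (r 0) g ` free_module V (r 0)
        = (\<lambda>w. coset (lc (r 0) (column f) w 0)) ` free_module V (r 0)"
      by (rule image_cong[OF refl]) (rule aug)
    have sub: "(\<lambda>w. coset (lc (r 0) (column f) w 0)) ` free_module V (r 0) \<subseteq> coset ` pols V"
      using lcp by auto
    have "augmentation M (r 0) g ` free_module V (r 0) = carrier M \<longleftrightarrow>
        coset ` pols V \<subseteq> (\<lambda>w. coset (lc (r 0) (column f) w 0)) ` free_module V (r 0)"
      unfolding eq quotient_carrier using sub by (simp only: set_eq_subset simp_thms)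
    also have "\<dots> \<longleftrightarrow> (\<forall>p \<in> pols V. \<exists>w \<in> free_module V (r 0). coset p = coset (lc (r 0) (column f) w 0))"
      by (simp only: image_subset_iff image_iff)
    also have "\<dots> \<longleftrightarrow> (\<forall>p \<in> pols V. \<exists>w \<in> free_module V (r 0). p - lc (r 0) (column f) w 0 \<in> J)"
      by (intro ball_cong bex_cong refl coset_eq_iff lcp)
    finally show ?thesis .
  qed
  have ker: "{w \<in> free_module V (r 0). augmentation M (r 0) g w = \<zero>\<^bsub>M\<^esub>}
      = {w \<in> free_module V (r 0). lc (r 0) (column f) w 0 \<in> J}"
    by (intro Collect_cong conj_cong refl) (simp add: aug quotient_zero coset_eq_iff[OF lcp pols_0])
  have gens_f: "\<forall>s<r 0. f s \<in> homogeneous_part V (d 0 s)" using f by blast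
  have const: "(\<forall>i. \<forall>s < r (Suc i). \<forall>t < r i. A (Suc i) s t \<in> irrelevant_ideal V) \<longrightarrow>
      (\<forall>i. \<forall>s < r (Suc i). \<forall>t. const_term (?A i s t) = 0)"
    by (simp add: irrelevant_ideal_const_term[where V = V])
  show ?thesis
    unfolding minimal_graded_free_resolution_def gres_def rows surj ker free_map_lc One_nat_def
    using gens gens_f const by argo
qed

lemma resolution_gres:
  assumes "minimal_graded_free_resolution V M r d g A"
  shows "\<exists>f A'. gres V J r d f A'"
proof -
  have "\<forall>s<r 0. g s \<in> coset ` homogeneous_part V (d 0 s)"
    using assms unfolding minimal_graded_free_resolution_def
    by (simp add: graph_quotient_def J(2)[symmetric] Let_def)
  then have "\<forall>s. \<exists>h. s < r 0 \<longrightarrow> h \<in> homogeneous_part V (d 0 s) \<and> g s = coset h"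
    unfolding image_iff by blast
  from choice[OF this] obtain f
    where "\<And>s. s < r 0 \<Longrightarrow> f s \<in> homogeneous_part V (d 0 s)" "\<And>s. s < r 0 \<Longrightarrow> g s = coset (f s)"
    by blast
  from minimal_graded_free_resolution_iff[of r f d g A, OF this] assms show ?thesis by blast
qed

lemma graded_betti_pure:
  assumes pure: "pure_res V J \<delta> r A" and \<delta>: "\<delta> 0 = 0" "strict_mono \<delta>"
  shows "graded_betti V M i (\<delta> i) = r i"
proof -
  let ?d = "\<lambda>i (_::nat). \<delta> i" and ?f = "\<lambda>_::nat. 1 :: ('v, 'k) mpoly"
  let ?A = "\<lambda>i. A (i - 1)"
  have f: "?f s \<in> homogeneous_part V (?d 0 s)" for s
    using homogeneous_single[of 0 V "1::'k"] by (simp add: \<delta>)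
  note r0 = pure_resD(1)[OF pure] and rows = pure_resD(2)[OF pure]
  have lc1: "lc (r 0) (column ?f) w 0 = w 0" for w by (simp add: lc_def r0 column_def)
  have "(if t < r j then A j s t else 0) = A j s t" if "s < r (Suc j)" for j s t
    using rows[OF that] by (auto simp: hvec_def free_module_def)
  then have lcA: "lc (r (Suc j)) (\<lambda>s t. if t < r j then A j s t else 0) w = lc (r (Suc j)) (A j) w" for j w
    by (intro lc_cong) auto
  have entry: "A j s t \<in> homogeneous_part V (\<delta> (Suc j) - \<delta> j)" if "s < r (Suc j)" for j s t
    using rows[OF that] by (cases "A j s t = 0") (auto simp: hvec_def)
  \<comment> \<open>Strict growth of \<open>\<delta>\<close> forces all entries into positive
    degree; this is where minimality of the constructed resolution comes from.\<close>
  have pos: "0 < \<delta> (Suc j) - \<delta> j" for j using \<delta>(2) by (simp add: strict_mono_Suc_iff)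
  have rows': "(\<lambda>t. if t < r j then A j s t else 0) \<in> hvec V (r j) (\<lambda>_. \<delta> j) (\<delta> (Suc j))"
    if "s < r (Suc j)" for j s
  proof -
    have "(\<lambda>t. if t < r j then A j s t else 0) = A j s"
      using rows[OF that] by (auto simp: hvec_def free_module_def fun_eq_iff)
    then show ?thesis using rows[OF that] by simp
  qed
  have surj: "\<exists>w\<in>free_module V (r 0). p - w 0 \<in> J" if "p \<in> pols V" for p
    by (rule bexI[of _ "\<lambda>t. if t = 0 then p else 0"]) (use that in \<open>auto simp: J(1) free_module_def r0\<close>)
  have gres: "gres V J r ?d ?f (\<lambda>i s t. if t < r i then ?A (Suc i) s t else 0)"
    unfolding gres_def lc1 lcA diff_Suc_1
    using f rows' surj pure_resD(3,4)[OF pure] const_term_homogeneous[OF entry pos]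
    by (auto 0 0)
  have min: "minimal_graded_free_resolution V M r ?d (\<lambda>_. coset 1) ?A"
  proof -
    have "minimal_graded_free_resolution V M r ?d (\<lambda>_. coset 1) ?A \<longleftrightarrow>
      gres V J r ?d ?f (\<lambda>i s t. if t < r i then ?A (Suc i) s t else 0) \<and>
      (\<forall>i. \<forall>s < r (Suc i). \<forall>t < r i. ?A (Suc i) s t \<in> irrelevant_ideal V)"
      by (rule minimal_graded_free_resolution_iff) (rule f refl)+
    then show ?thesis using gres homogeneous_irrelevant_ideal[OF entry pos] by simp
  qed
  have card: "card {s. s < r i \<and> \<delta> i = \<delta> i} = r i" by simp
  show ?thesis
    unfolding graded_betti_def
  proof (rule the_equality)
    show "\<exists>r' d g A. minimal_graded_free_resolution V M r' d g A \<and> r i = card {s. s < r' i \<and> d i s = \<delta> i}"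
      by (intro exI conjI) (rule min, rule card[symmetric])
  next
    fix b assume "\<exists>r' d g A. minimal_graded_free_resolution V M r' d g A \<and> b = card {s. s < r' i \<and> d i s = \<delta> i}"
    then obtain r' d g A' where *: "minimal_graded_free_resolution V M r' d g A'" "b = card {s. s < r' i \<and> d i s = \<delta> i}"
      by blast
    \<comment> \<open>Uniqueness for the definite description: any competitor is compared with the
      pure resolution in both directions.\<close>
    then obtain f' B where "gres V J r' d f' B" using resolution_gres by blast
    then show "b = r i"
      using gres_betti_le[OF U J(1) gres, of r' d f' B i "\<delta> i"] gres_betti_le[OF U J(1) _ gres, of r' d f' B i "\<delta> i"]
      unfolding *(2) card by linarith
  qed
qed

end

abbreviation threshold_nonedges :: "nat \<Rightarrow> nat set \<Rightarrow> (nat \<times> nat) set" where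
  "threshold_nonedges n \<sigma> \<equiv> nonedges_before \<sigma> (n + 1) 0"

text \<open>The set \<open>\<sigma>\<close> is arbitrary: \<open>a < b\<close> and
  \<open>b < n + 1\<close> discard its possible element 0 and those above \<open>n\<close>.
  Commutativity of the product reconciles unordered non-edges with ordered pairs.\<close>

lemma nonedge_ideal_threshold_graph:
  "nonedge_ideal (threshold_graph n \<sigma>) =
    (mon_ideal {0..n} (edge_upset (threshold_nonedges n \<sigma>)) :: (nat, 'k::field) mpoly set)"
proof -
  let ?mon = "\<lambda>(u, v). Poly_Mapping.single u (1::nat) + Poly_Mapping.single v 1"
  have nonedge: "u \<le> n \<and> v \<le> n \<and> u \<noteq> v \<and> {u, v} \<notin> {{u, v} |u v. u < v \<and> v \<le> n \<and> v \<notin> \<sigma>} \<longleftrightarrow>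
      (u, v) \<in> threshold_nonedges n \<sigma> \<or> (v, u) \<in> threshold_nonedges n \<sigma>" for u v
  proof (cases u v rule: linorder_cases)
    case less
    then show ?thesis by (auto simp: nonedges_before_def doubleton_eq_iff)
  next
    case greater
    then show ?thesis by (auto simp: nonedges_before_def doubleton_eq_iff)
  qed (auto simp: nonedges_before_def)
  have var: "var u * var v = Poly_Mapping.single (?mon (u, v)) (1::'k)" for u v
    by (simp add: var_def mult_single)
  have gens: "{var u * var v | u v. u \<in> fst (threshold_graph n \<sigma>) \<and> v \<in> fst (threshold_graph n \<sigma>) \<and> u \<noteq> v \<and>
      {u, v} \<notin> snd (threshold_graph n \<sigma>)}
      = (\<lambda>a. Poly_Mapping.single a (1::'k)) ` ?mon ` threshold_nonedges n \<sigma>" (is "?L = ?R")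
  proof (intro equalityI subsetI)
    fix x assume "x \<in> ?L"
    then obtain u v where uv: "x = var u * var v"
      "(u, v) \<in> threshold_nonedges n \<sigma> \<or> (v, u) \<in> threshold_nonedges n \<sigma>"
      using nonedge by (auto simp: threshold_graph_def)
    then have "x = var v * var u" by (simp add: mult.commute)
    with uv show "x \<in> ?R" unfolding var by blast
  next
    fix x assume "x \<in> ?R"
    then obtain u v where uv: "(u, v) \<in> threshold_nonedges n \<sigma>" "x = var u * var v"
      unfolding var by auto
    then show "x \<in> ?L" using nonedge[of u v] by (auto simp: threshold_graph_def)
  qed
  have "Idl\<^bsub>poly_ring {0..n}\<^esub> ((\<lambda>a. Poly_Mapping.single a (1::'k)) ` ?mon ` threshold_nonedges n \<sigma>)
      = mon_ideal {0..n} (edge_upset (threshold_nonedges n \<sigma>))"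
  proof (rule genideal_monomials)
    show "Poly_Mapping.keys a \<subseteq> {0..n}" if "a \<in> ?mon ` threshold_nonedges n \<sigma>" for a
      using that by (auto simp: keys_add_nat nonedges_before_def)
    show "edge_upset (threshold_nonedges n \<sigma>) m \<longleftrightarrow> (\<exists>a\<in>?mon ` threshold_nonedges n \<sigma>. \<exists>b. m = a + b)" for m
    proof -
      have "(\<exists>b. m = ?mon e + b) \<longleftrightarrow> 0 < Poly_Mapping.lookup m (fst e) \<and> 0 < Poly_Mapping.lookup m (snd e)"
        if "e \<in> threshold_nonedges n \<sigma>" for e
        using that edge_multiple_iff[of "fst e" "snd e" m] by (auto simp: nonedges_before_def split_beta)
      then show ?thesis by (auto simp: edge_upset_def split_beta)
    qed
  qed
  then show ?thesis unfolding nonedge_ideal_def gens by (simp add: threshold_graph_def)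
qed

lemma linear_betti_threshold_graph:
  assumes "k > 0"
  shows "linear_betti TYPE('k::field) (threshold_graph n \<sigma>) k =
    (\<Sum>(a, b)\<in>threshold_nonedges n \<sigma>. nonedge_rank \<sigma> a b choose (k - 1))"
proof -
  let ?G = "threshold_graph n \<sigma>" and ?E = "threshold_nonedges n \<sigma>"
  have V: "fst ?G = {0..n}" by (simp add: threshold_graph_def)
  obtain A :: "nat \<Rightarrow> nat \<Rightarrow> nat \<Rightarrow> (nat, 'k) mpoly"
    where A: "pure_res {0..n} (mon_ideal {0..n} (edge_upset ?E)) linear_shift (ranks \<sigma> ?E) A"
    using threshold_resolution[of "n + 1" n \<sigma>] by auto
  have "graded_betti (fst ?G) (graph_quotient ?G :: ((nat, 'k) mpoly, (nat, 'k) mpoly set) graded_module)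
      k (linear_shift k) = ranks \<sigma> ?E k"
  proof (rule graded_betti_pure[OF upset_edge_upset])
    show "mon_ideal {0..n} (edge_upset ?E) = mon_ideal (fst ?G) (edge_upset ?E)" unfolding V ..
    show "mon_ideal {0..n} (edge_upset ?E) = nonedge_ideal ?G" by (rule nonedge_ideal_threshold_graph[symmetric])
    show "pure_res (fst ?G) (mon_ideal {0..n} (edge_upset ?E)) linear_shift (ranks \<sigma> ?E) A" unfolding V by (rule A)
  qed (simp_all add: linear_shift_def strict_mono_Suc_iff)
  then show ?thesis using assms by (simp add: linear_betti_def linear_shift_def ranks_def)
qed

section \<open>The expected Betti number\<close>

text \<open>The number of elements above \<open>a\<close> takes each value below
  \<open>card Y\<close> once. Adjoining a new minimum leaves the other counts unchanged and adds the
  top exponent.\<close>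

lemma sum_power_card_greater:
  fixes Y :: "nat set" and q :: "'a::comm_semiring_1"
  assumes "finite Y"
  shows "(\<Sum>a\<in>Y. q ^ card {y \<in> Y. a < y}) = (\<Sum>i<card Y. q ^ i)"
  using assms
proof (induction Y rule: finite_linorder_min_induct)
  case (insert b A)
  have "{y \<in> insert b A. a < y} = {y \<in> A. a < y}" if "a \<in> A" for a
    using insert.hyps(2) that by auto
  moreover have "{y \<in> insert b A. b < y} = A" using insert.hyps(2) by auto
  moreover have "b \<notin> A" using insert.hyps(2) by blast
  ultimately show ?case using insert by (simp add: add.commute)
qed simp

lemma sum_nonedges:
  fixes g :: "nat \<Rightarrow> nat \<Rightarrow> nat"
  shows "(\<Sum>(a, b)\<in>threshold_nonedges n \<sigma>. g a b) = (\<Sum>b\<le>n. \<Sum>a<b. of_bool (b \<in> \<sigma>) * g a b)"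
proof -
  have "(\<Sum>b\<le>n. \<Sum>a<b. of_bool (b \<in> \<sigma>) * g a b)
      = (\<Sum>(b, a)\<in>(SIGMA b:{..n}. {..<b}). of_bool (b \<in> \<sigma>) * g a b)"
    by (rule sum.Sigma) auto
  also have "\<dots> = (\<Sum>(b, a)\<in>{(b, a) \<in> (SIGMA b:{..n}. {..<b}). b \<in> \<sigma>}. g a b)"
    by (rule sum.mono_neutral_cong_right) auto
  also have "\<dots> = (\<Sum>(a, b)\<in>threshold_nonedges n \<sigma>. g a b)"
    by (rule sum.reindex_bij_witness[of _ prod.swap prod.swap]) (auto simp: nonedges_before_def)
  finally show ?thesis by simp
qed

text \<open>The sets \<open>X\<close> that avoid \<open>a\<close> and have all elements above
  \<open>a\<close> in \<open>\<sigma>\<close> are the subsets of the set whose size is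
  \<open>nonedge_rank \<sigma> a b\<close>.\<close>

lemma nonedge_rank_choose:
  assumes "a < b"
  shows "of_bool (b \<in> \<sigma>) * (nonedge_rank \<sigma> a b choose j)
    = (\<Sum>X\<in>{X. X \<subseteq> {..<b} - {a} \<and> card X = j}. of_bool (insert b {y \<in> X. a < y} \<subseteq> \<sigma>))"
proof -
  have fin: "finite {X. X \<subseteq> {..<b} - {a} \<and> card X = j}" by (simp add: finite_Collect_conjI)
  have "{X. X \<subseteq> {..<b} - {a} \<and> card X = j} \<inter> {X. insert b {y \<in> X. a < y} \<subseteq> \<sigma>}
      = (if b \<in> \<sigma> then {X. X \<subseteq> {..<a} \<union> (\<sigma> \<inter> {a<..<b}) \<and> card X = j} else {})"
    using assms by (auto simp: subset_iff)
  then show ?thesis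
    unfolding sum_of_bool_eq[OF fin] by (simp add: n_subsets nonedge_rank_def)
qed

text \<open>Double counting: an element \<open>a\<close> with a set avoiding it is the same as a set
  \<open>Y\<close> with a marked element.\<close>

lemma sum_remove_element:
  fixes F :: "nat set \<Rightarrow> nat \<Rightarrow> 'a::comm_monoid_add"
  assumes "k \<ge> 1"
  shows "(\<Sum>a<b. \<Sum>X\<in>{X. X \<subseteq> {..<b} - {a} \<and> card X = k - 1}. F (insert a X) a)
    = (\<Sum>Y\<in>{Y. Y \<subseteq> {..<b} \<and> card Y = k}. \<Sum>a\<in>Y. F Y a)"
proof -
  have fin: "finite Y" if "Y \<subseteq> {..<b}" for Y :: "nat set"
    using that by (rule finite_subset) simp
  have card: "card (insert a X) = k" if "X \<subseteq> {..<b} - {a}" "card X = k - 1" for a X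
  proof -
    have "finite X" "a \<notin> X" using that fin[of X] by auto
    then show ?thesis using that(2) assms by simp
  qed
  have "(\<Sum>a<b. \<Sum>X\<in>{X. X \<subseteq> {..<b} - {a} \<and> card X = k - 1}. F (insert a X) a)
      = (\<Sum>(a, X)\<in>(SIGMA a:{..<b}. {X. X \<subseteq> {..<b} - {a} \<and> card X = k - 1}). F (insert a X) a)"
    by (rule sum.Sigma) (simp_all add: finite_Collect_conjI)
  also have "\<dots> = (\<Sum>(Y, a)\<in>(SIGMA Y:{Y. Y \<subseteq> {..<b} \<and> card Y = k}. Y). F Y a)"
    by (rule sum.reindex_bij_witness[of _ "\<lambda>(Y, a). (a, Y - {a})" "\<lambda>(a, X). (insert a X, a)"])
      (use assms fin card in \<open>auto simp: insert_absorb card_Diff_singleton\<close>)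
  also have "\<dots> = (\<Sum>Y\<in>{Y. Y \<subseteq> {..<b} \<and> card Y = k}. \<Sum>a\<in>Y. F Y a)"
    by (rule sum.Sigma[symmetric]) (auto simp: finite_Collect_conjI intro: fin)
  finally show ?thesis .
qed

text \<open>The set \<open>W\<close> of \<open>k + 1\<close> vertices is split into its maximum \<open>b\<close> and the rest \<open>Y\<close>.\<close>

lemma linear_betti_count:
  assumes "k \<ge> 1"
  shows "linear_betti TYPE('k::field) (threshold_graph n \<sigma>) k =
    (\<Sum>b\<le>n. \<Sum>Y\<in>{Y. Y \<subseteq> {..<b} \<and> card Y = k}. \<Sum>a\<in>Y. of_bool (insert b {y \<in> Y. a < y} \<subseteq> \<sigma>))"
proof -
  have "linear_betti TYPE('k) (threshold_graph n \<sigma>) k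
      = (\<Sum>b\<le>n. \<Sum>a<b. \<Sum>X\<in>{X. X \<subseteq> {..<b} - {a} \<and> card X = k - 1}. of_bool (insert b {y \<in> X. a < y} \<subseteq> \<sigma>))"
  proof -
    have "k > 0" using assms by simp
    then show ?thesis
      unfolding linear_betti_threshold_graph[OF \<open>k > 0\<close>] sum_nonedges
      by (intro sum.cong refl nonedge_rank_choose) simp
  qed
  also have "\<dots> = (\<Sum>b\<le>n. \<Sum>Y\<in>{Y. Y \<subseteq> {..<b} \<and> card Y = k}. \<Sum>a\<in>Y. of_bool (insert b {y \<in> Y. a < y} \<subseteq> \<sigma>))"
  proof (rule sum.cong[OF refl])
    fix b
    \<comment> \<open>Only elements strictly above \<open>a\<close> are tested, so the summand
      depends on \<open>insert a X\<close> and \<open>a\<close> alone, as the double counting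
      requires.\<close>
    have "{y \<in> insert a X. a < y} = {y \<in> X. a < y}" for a and X :: "nat set" by auto
    then show "(\<Sum>a<b. \<Sum>X\<in>{X. X \<subseteq> {..<b} - {a} \<and> card X = k - 1}. of_bool (insert b {y \<in> X. a < y} \<subseteq> \<sigma>))
        = (\<Sum>Y\<in>{Y. Y \<subseteq> {..<b} \<and> card Y = k}. \<Sum>a\<in>Y. of_bool (insert b {y \<in> Y. a < y} \<subseteq> \<sigma>) :: nat)"
      using sum_remove_element[OF assms, where F = "\<lambda>Y a. of_bool (insert b {y \<in> Y. a < y} \<subseteq> \<sigma>)" and b = b]
      by (simp only:)
  qed
  finally show ?thesis .
qed

text \<open>The indicator is a product over the coordinates, with factor 1 outside \<open>T\<close>,
  so independence turns its expectation into a product.\<close>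

lemma expectation_all_true:
  assumes p: "0 \<le> p" "p \<le> 1" and T: "T \<subseteq> A" "finite A"
  shows "measure_pmf.expectation (Pi_pmf A False (\<lambda>_. bernoulli_pmf p)) (\<lambda>\<omega>. of_bool (T \<subseteq> {i \<in> A. \<omega> i}))
    = (p ^ card T :: real)"
proof -
  let ?f = "\<lambda>x v. if x \<in> T then of_bool v else 1 :: real"
  have "of_bool (T \<subseteq> {i \<in> A. \<omega> i}) = (\<Prod>x\<in>A. ?f x (\<omega> x))" for \<omega>
  proof -
    have "(\<Prod>x\<in>A. ?f x (\<omega> x)) = (\<Prod>x\<in>T. of_bool (\<omega> x))"
      using T by (intro prod.mono_neutral_cong_right) auto
    also have "\<dots> = of_bool (\<forall>x\<in>T. \<omega> x)"
      using finite_subset[OF T] by (induction T rule: finite_induct) auto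
    finally show ?thesis using T(1) by (auto simp: subset_iff)
  qed
  then have "measure_pmf.expectation (Pi_pmf A False (\<lambda>_. bernoulli_pmf p)) (\<lambda>\<omega>. of_bool (T \<subseteq> {i \<in> A. \<omega> i}))
      = (\<Prod>x\<in>A. measure_pmf.expectation (bernoulli_pmf p) (?f x))"
    using T(2) by (simp only:) (rule expectation_prod_Pi_pmf, auto intro: integrable_measure_pmf_finite)
  also have "\<dots> = (\<Prod>x\<in>A. if x \<in> T then p else 1)"
    by (rule prod.cong) (use p in auto)
  also have "\<dots> = (\<Prod>x\<in>T. p)"
    using T by (intro prod.mono_neutral_cong_right) auto
  finally show ?thesis by simp
qed

theorem theorem4p8:
  fixes p :: real and n k :: nat
  assumes "0 < p" and "p < 1" and "1 \<le> k" and "k \<le> n"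
  shows "measure_pmf.expectation (random_threshold_graph n p)
           (\<lambda>T. real (linear_betti TYPE('k::field) T k)) =
         real ((n + 1) choose (k + 1)) * (p * (1 - p ^ k) / (1 - p))"
proof -
  let ?P = "Pi_pmf {1..n} False (\<lambda>_. bernoulli_pmf p)"
  let ?I = "\<lambda>b Y a \<omega>. of_bool (insert b {y \<in> Y. a < y} \<subseteq> {i \<in> {1..n}. \<omega> i}) :: real"
  have "finite (set_pmf ?P)"
    by (rule finite_subset[OF set_Pi_pmf_subset']) (auto intro: finite_PiE_dflt)
  then have int: "integrable (measure_pmf ?P) f" for f :: "(nat \<Rightarrow> bool) \<Rightarrow> real"
    by (rule integrable_measure_pmf_finite)
  have E: "measure_pmf.expectation ?P (?I b Y a) = p * p ^ card {y \<in> Y. a < y}"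
    if "b \<le> n" "Y \<subseteq> {..<b}" "a \<in> Y" for b Y a
  proof -
    have "finite Y" using that(2) by (rule finite_subset) simp
    then have "card (insert b {y \<in> Y. a < y}) = Suc (card {y \<in> Y. a < y})"
      using that(2) by (subst card_insert_disjoint) auto
    \<comment> \<open>All these elements exceed \<open>a\<close>, hence are positive: vertex 0 has
      no random coordinate.\<close>
    moreover have "insert b {y \<in> Y. a < y} \<subseteq> {1..n}" using that by (auto simp: subset_iff)
    ultimately show ?thesis using assms expectation_all_true[of p "insert b {y \<in> Y. a < y}" "{1..n}"] by simp
  qed
  have "measure_pmf.expectation (random_threshold_graph n p) (\<lambda>T. real (linear_betti TYPE('k) T k))
      = measure_pmf.expectation ?P (\<lambda>\<omega>. \<Sum>b\<le>n. \<Sum>Y\<in>{Y. Y \<subseteq> {..<b} \<and> card Y = k}. \<Sum>a\<in>Y. ?I b Y a \<omega>)"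
    by (simp add: random_threshold_graph_def linear_betti_count[OF assms(3)])
  also have "\<dots> = (\<Sum>b\<le>n. \<Sum>Y\<in>{Y. Y \<subseteq> {..<b} \<and> card Y = k}. \<Sum>a\<in>Y. measure_pmf.expectation ?P (?I b Y a))"
    by (simp only: Bochner_Integration.integral_sum int)
  \<comment> \<open>The factor \<open>p\<close> comes from \<open>b\<close>; as \<open>a\<close>
    runs through \<open>Y\<close>, the number of elements of \<open>Y\<close> above it runs through
    \<open>0, ..., k - 1\<close>.\<close>
  also have "\<dots> = (\<Sum>b\<le>n. \<Sum>Y\<in>{Y. Y \<subseteq> {..<b} \<and> card Y = k}. p * (\<Sum>i<k. p ^ i))"
  proof (intro sum.cong refl)
    fix b Y assume "b \<in> {..n}" "Y \<in> {Y. Y \<subseteq> {..<b} \<and> card Y = k}"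
    moreover from this have "finite Y" by (auto intro: finite_subset)
    ultimately show "(\<Sum>a\<in>Y. measure_pmf.expectation ?P (?I b Y a)) = p * (\<Sum>i<k. p ^ i)"
      using E[of b Y] sum_power_card_greater[of Y p] by (simp add: sum_distrib_left[symmetric])
  qed
  also have "\<dots> = real (\<Sum>b\<le>n. b choose k) * (p * (\<Sum>i<k. p ^ i))"
    by (simp add: n_subsets sum_distrib_right)
  \<comment> \<open>The hockey-stick identity: sets of \<open>k + 1\<close> vertices sorted by their
    maximum.\<close>
  also have "(\<Sum>b\<le>n. b choose k) = (n + 1) choose (k + 1)"
    by (simp add: sum_choose_upper)
  also have "(\<Sum>i<k. p ^ i) = (1 - p ^ k) / (1 - p)"
    using assms by (simp add: sum_gp_strict)
  finally show ?thesis by simp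
qed

end
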